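(* Let $0<L<\lambda$, $v_{\max}>0$, $v^*\in(0,v_{\max})$, $\mu>0$. Let $\Phi\in C^3((L,+\infty);\mathbb{R}_+)$ satisfy $\lim_{x\to L^+}\Phi(x)=+\infty$, $\Phi(x)=0$ for $x\ge\lambda$, and $\Phi'(x)<0$, $\Phi''(x)>0$ for $x\in(L,\lambda)$. Let $b:\mathbb{R}\to(v^*-v_{\max},v^* )$ be a $C^2$ increasing function with $b(0)=0$, $xb(x)>0$ for $x\ne0$, and $b'(x)>0$ for all $x\in\mathbb{R}$. For $y,x\in\mathbb{R}$ define $$P(y,x)=\frac{y\left(v_{\max}-2v^*+2b(x)\right)+\sqrt{y^2v_{\max}^2+4\left(v_{\max}-v^*+b(x)\right)\left(v^*-b(x)\right)}}{2(1+y^2)},\qquad \kappa(y,x)=yP(y,x)-b(x).$$ Let $D=(L-\lambda,+\infty)\times\mathbb{R}$, $S=\mathbb{R}_+\times\mathbb{R}$, and for $u=(u_z,u_y)$, $x=(z,y)$, $w=(w_z,w_y)$ in $D$ define $h(x)=h(z,y)=y$ and $$f(u,x,w)=\begin{bmatrix}\kappa\left(u_y,\Phi'(z+\lambda)-\Phi'(u_z+\lambda)\right)-\kappa\left(y,\Phi'(w_z+\lambda)-\Phi'(z+\lambda)\right)\\[4pt]-\mu y-\dfrac{\Phi'(w_z+\lambda)-\Phi'(z+\lambda)}{v_{\max}^2}\,P\left(y,\Phi'(w_z+\lambda)-\Phi'(z+\lambda)\right)\end{bmatrix}.$$ Let $$V(z,y)=\frac{v_{\max}^2}{2}y^2+\Phi(\lambda+z)\quad\text{for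 }(z,y)\in D.$$ Then there exist constants $K,\Lambda>0$ such that, with $\Omega=\mathbb{R}_+\times[-\Lambda,\Lambda]$, the string $$(\Sigma_n):\ \dot x_i=f(x_{i-1},x_i,x_{i+1}),\quad y_i=h(x_i),\quad i=1,\dots,n,\qquad x_0=u\in\Omega,\ x_{n+1}=w\in S\qquad(n\in\mathbb{N})$$ is $L^2$ string stable, and the string stability estimate $$\|y_i\|_{[0,t],2}\le a_1\left(\|h(u)\|_{[0,t],2}\right)+a_2\left(\|h(w)\|_{[0,t],2}\right)+Q_n(\xi)$$ (for all $n\in\mathbb{N}$, $\xi\in D^n$, $u\in\mho(\Omega)$, $w\in\mho(S)$, $t\ge0$, $i=1,\dots,n$, along the solution of $(\Sigma_n)$ with $x(0)=\xi$) holds with $a_1(s)=Ks$ for all $s\ge0$, $a_2(s)\equiv0$ and $$Q_n(\xi_1,\dots,\xi_n)=\left(\frac{1}{\mu v_{\max}^2}\sum_{i=1}^nV(\xi_i)\right)^{1/2}\quad\text{for all }(\xi_1,\dots,\xi_n)\in D^n.$$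
   Context: Notation. $\mathbb{R}_+=[0,+\infty)$ and $|\cdot|$ is the Euclidean norm. For a set $A\subseteq\mathbb{R}^q$, $\mho(A)$ is the set of Lebesgue measurable, locally essentially bounded functions $u:\mathbb{R}_+\to A$ such that for every $T>0$ there is a compact set $\Omega_T\subseteq A$ with $u(t)\in\Omega_T$ for almost every $t\in[0,T]$. For a locally essentially bounded measurable signal $y$ on $\mathbb{R}_+$ and $t\ge0$: $\|y\|_{[0,t],2}=\left(\int_0^t|y(s)|^2\,ds\right)^{1/2}$. Forward completeness. The state of $(\Sigma_n)$ is $x=(x_1,\dots,x_n)\in D^n$, where $x_i=(z_i,y_i)\in D$. The system $(\Sigma_n)$ is forward complete if for every $\xi\in D^n$, $u\in\mho(\Omega)$, $w\in\mho(S)$ the (unique, Carathéodory) solution $x(t)\in D^n$ with $x(0)=\xi$ exists for all $t\ge 0$. $L^2$ string stability. The string $(\Sigma_n)_{n\in\mathbb{N}}$ is $L^2$ string stable if there exist non-decreasing functions $a_1,a_2\in C^0(\mathbb{R}_+;\mathbb{R}_+)$, independent of $n$, such that for every $n\in\mathbb{N}$: (i) $(\Sigma_n)$ is forward complete, and (ii) there exists $Q_n\in C^0(D^n;\mathbb{R}_+)$ such that for every $\xi\in D^n$, $u\in\mho(\Omega)$, $w\in\mho(S)$ the solution of $(\Sigma_n)$ with $x(0)=\xi$ satisfies, for all $t\ge0$ and $i=1,\dots,n$, $\|y_i\|_{[0,t],2}\le a_1(\|h(u)\|_{[0,t],2})+a_2(\|h(w)\|_{[0,t],2})+Q_n(\xi)$.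 *)

theory Defs
  imports "HOL-Analysis.Analysis"
begin

section \<open>Function spaces and signals\<close>

text \<open>Intended for open \<open>A\<close>, where the derivative at a point of \<open>A\<close> does not depend on the values
  of \<open>g\<close> outside \<open>A\<close>.\<close>

definition Ck_on :: "nat \<Rightarrow> (real \<Rightarrow> real) \<Rightarrow> real set \<Rightarrow> bool" where
  "Ck_on k g A \<longleftrightarrow>
     (\<forall>j<k. \<forall>x\<in>A. (deriv ^^ j) g differentiable (at x)) \<and> continuous_on A ((deriv ^^ k) g)"

definition nonneg_C0 :: "'a::topological_space set \<Rightarrow> ('a \<Rightarrow> real) set" where
  "nonneg_C0 A = {g. continuous_on A g \<and> (\<forall>x\<in>A. 0 \<le> g x)}"

text \<open>The set \<open>\<mho>(A)\<close>. Signals live on \<open>{0..}\<close>; their values at negative times are never used.\<close>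

definition input_signals :: "'a::euclidean_space set \<Rightarrow> (real \<Rightarrow> 'a) set" where
  "input_signals A = {u.
     (\<forall>t\<ge>0. u t \<in> A) \<and>
     u \<in> borel_measurable (lebesgue_on {0..}) \<and>
     (\<forall>T>0. \<exists>C. AE t\<in>{0..T} in lebesgue. norm (u t) \<le> C) \<and>
     (\<forall>T>0. \<exists>\<Omega>. compact \<Omega> \<and> \<Omega> \<subseteq> A \<and> (AE t\<in>{0..T} in lebesgue. u t \<in> \<Omega>))}"

definition L2_norm_upto :: "real \<Rightarrow> (real \<Rightarrow> 'a::euclidean_space) \<Rightarrow> real" where
  "L2_norm_upto t y = sqrt (LINT s:{0..t}|lebesgue. (norm (y s))\<^sup>2)"

text \<open>A set \<open>\<D>\<close> with \<open>\<D> division_of \<Union>\<D>\<close> is precisely a finite family of nonempty, non-overlapping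
  compact intervals \<open>k = {Inf k..Sup k}\<close>, so this is the usual epsilon-delta definition of
  absolute continuity.\<close>

definition abs_continuous_on :: "real set \<Rightarrow> (real \<Rightarrow> 'a::real_normed_vector) \<Rightarrow> bool" where
  "abs_continuous_on A g \<longleftrightarrow>
     (\<forall>\<epsilon>>0. \<exists>\<delta>>0. \<forall>\<D>. \<D> division_of \<Union>\<D> \<and> \<Union>\<D> \<subseteq> A \<and> (\<Sum>k\<in>\<D>. Sup k - Inf k) < \<delta> \<longrightarrow>
        (\<Sum>k\<in>\<D>. norm (g (Sup k) - g (Inf k))) < \<epsilon>)"

definition locally_abs_continuous_on :: "real set \<Rightarrow> (real \<Rightarrow> 'a::real_normed_vector) \<Rightarrow> bool" where
  "locally_abs_continuous_on J g \<longleftrightarrow> (\<forall>a b. {a..b} \<subseteq> J \<longrightarrow> abs_continuous_on {a..b} g)"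


section \<open>Strings of systems\<close>

text \<open>A state \<open>(x\<^sub>1, \<dots>, x\<^sub>n)\<close> in \<open>D\<^sup>n\<close> is an extensional function on \<open>{1..n}\<close>. Continuity of functions
  on \<open>D\<^sup>n\<close> refers to the product topology on \<open>nat \<Rightarrow> 'a\<close>, whose restriction to this set is the
  usual topology of \<open>D\<^sup>n\<close>.\<close>

definition states :: "'a set \<Rightarrow> nat \<Rightarrow> (nat \<Rightarrow> 'a) set" where
  "states D n = (\<Pi>\<^sub>E i\<in>{1..n}. D)"

text \<open>The state with the boundary conventions \<open>x\<^sub>0 = u\<close> and \<open>x\<^bsub>n+1\<^esub> = w\<close>.\<close>

definition with_boundary :: "nat \<Rightarrow> 'a \<Rightarrow> 'a \<Rightarrow> (nat \<Rightarrow> 'a) \<Rightarrow> nat \<Rightarrow> 'a" where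
  "with_boundary n u w x = x(0 := u, Suc n := w)"

text \<open>Caratheodory solutions on an interval \<open>J\<close>, here \<open>{0..}\<close> or \<open>{0..<T}\<close>.\<close>

definition string_solution ::
  "('a::euclidean_space \<Rightarrow> 'a \<Rightarrow> 'a \<Rightarrow> 'a) \<Rightarrow> 'a set \<Rightarrow> nat \<Rightarrow> (real \<Rightarrow> 'a) \<Rightarrow> (real \<Rightarrow> 'a)
    \<Rightarrow> real set \<Rightarrow> (real \<Rightarrow> nat \<Rightarrow> 'a) \<Rightarrow> bool" where
  "string_solution f D n u w J x \<longleftrightarrow>
     (\<forall>t\<in>J. x t \<in> states D n) \<and>
     (\<forall>i\<in>{1..n}. locally_abs_continuous_on J (\<lambda>t. x t i)) \<and>
     (AE t\<in>J in lebesgue. \<forall>i\<in>{1..n}.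
        let X = with_boundary n (u t) (w t) (x t)
        in ((\<lambda>s. x s i) has_vector_derivative f (X (i - 1)) (X i) (X (i + 1))) (at t within J))"

text \<open>The last conjunct says that the solution is unique: every solution from \<open>\<xi>\<close>, local or global,
  is a restriction of the global one.\<close>

definition forward_complete ::
  "('a::euclidean_space \<Rightarrow> 'a \<Rightarrow> 'a \<Rightarrow> 'a) \<Rightarrow> 'a set \<Rightarrow> 'a set \<Rightarrow> 'a set \<Rightarrow> nat \<Rightarrow> bool" where
  "forward_complete f D \<Omega> S n \<longleftrightarrow>
     (\<forall>\<xi>\<in>states D n. \<forall>u\<in>input_signals \<Omega>. \<forall>w\<in>input_signals S.
        \<exists>x. string_solution f D n u w {0..} x \<and> x 0 = \<xi> \<and>
            (\<forall>T>0. \<forall>x'. string_solution f D n u w {0..<T} x' \<and> x' 0 = \<xi> \<longrightarrow>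
               (\<forall>t\<in>{0..<T}. x' t = x t)))"

definition string_stability_estimate ::
  "('a::euclidean_space \<Rightarrow> 'a \<Rightarrow> 'a \<Rightarrow> 'a) \<Rightarrow> ('a \<Rightarrow> 'b::euclidean_space) \<Rightarrow> 'a set \<Rightarrow> 'a set \<Rightarrow> 'a set
    \<Rightarrow> nat \<Rightarrow> (real \<Rightarrow> real) \<Rightarrow> (real \<Rightarrow> real) \<Rightarrow> ((nat \<Rightarrow> 'a) \<Rightarrow> real) \<Rightarrow> bool" where
  "string_stability_estimate f h D \<Omega> S n a1 a2 Q \<longleftrightarrow>
     (\<forall>\<xi>\<in>states D n. \<forall>u\<in>input_signals \<Omega>. \<forall>w\<in>input_signals S.
        \<forall>x. string_solution f D n u w {0..} x \<and> x 0 = \<xi> \<longrightarrow>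
          (\<forall>t\<ge>0. \<forall>i\<in>{1..n}.
             L2_norm_upto t (\<lambda>s. h (x s i))
               \<le> a1 (L2_norm_upto t (\<lambda>s. h (u s))) + a2 (L2_norm_upto t (\<lambda>s. h (w s))) + Q \<xi>))"

definition L2_string_stable ::
  "('a::euclidean_space \<Rightarrow> 'a \<Rightarrow> 'a \<Rightarrow> 'a) \<Rightarrow> ('a \<Rightarrow> 'b::euclidean_space) \<Rightarrow> 'a set \<Rightarrow> 'a set \<Rightarrow> 'a set
    \<Rightarrow> bool" where
  "L2_string_stable f h D \<Omega> S \<longleftrightarrow>
     (\<exists>a1\<in>nonneg_C0 {0..}. \<exists>a2\<in>nonneg_C0 {0..}. mono_on {0..} a1 \<and> mono_on {0..} a2 \<and>
        (\<forall>n\<ge>1. forward_complete f D \<Omega> S n \<and>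
           (\<exists>Q\<in>nonneg_C0 (states D n). string_stability_estimate f h D \<Omega> S n a1 a2 Q)))"


section \<open>The vehicle string\<close>

definition P_fun :: "real \<Rightarrow> real \<Rightarrow> (real \<Rightarrow> real) \<Rightarrow> real \<Rightarrow> real \<Rightarrow> real" where
  "P_fun vmax vstar b y x =
     (y * (vmax - 2 * vstar + 2 * b x)
        + sqrt (y\<^sup>2 * vmax\<^sup>2 + 4 * (vmax - vstar + b x) * (vstar - b x)))
     / (2 * (1 + y\<^sup>2))"

definition kappa_fun :: "real \<Rightarrow> real \<Rightarrow> (real \<Rightarrow> real) \<Rightarrow> real \<Rightarrow> real \<Rightarrow> real" where
  "kappa_fun vmax vstar b y x = y * P_fun vmax vstar b y x - b x"

definition vehicle_rhs ::
  "real \<Rightarrow> real \<Rightarrow> real \<Rightarrow> real \<Rightarrow> (real \<Rightarrow> real) \<Rightarrow> (real \<Rightarrow> real)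
    \<Rightarrow> real \<times> real \<Rightarrow> real \<times> real \<Rightarrow> real \<times> real \<Rightarrow> real \<times> real" where
  "vehicle_rhs lam vmax vstar mu Phi b = (\<lambda>(uz, uy) (z, y) (wz, wy).
     (kappa_fun vmax vstar b uy (deriv Phi (z + lam) - deriv Phi (uz + lam))
        - kappa_fun vmax vstar b y (deriv Phi (wz + lam) - deriv Phi (z + lam)),
      - mu * y - (deriv Phi (wz + lam) - deriv Phi (z + lam)) / vmax\<^sup>2
          * P_fun vmax vstar b y (deriv Phi (wz + lam) - deriv Phi (z + lam))))"

definition vehicle_output :: "real \<times> real \<Rightarrow> real" where
  "vehicle_output = (\<lambda>(z, y). y)"

definition vehicle_V :: "real \<Rightarrow> real \<Rightarrow> (real \<Rightarrow> real) \<Rightarrow> real \<times> real \<Rightarrow> real" where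
  "vehicle_V lam vmax Phi = (\<lambda>(z, y). vmax\<^sup>2 / 2 * y\<^sup>2 + Phi (lam + z))"

end

theory Submission
  imports Defs
begin

text \<open>Since \<open>deriv Phi\<close> vanishes on \<open>{lam..}\<close>, only \<open>h(u)\<close> acts on the string. Write
  \<open>q\<^sub>i = deriv Phi (z\<^bsub>i+1\<^esub> + lam) - deriv Phi (z\<^sub>i + lam)\<close>. Along solutions the flux terms in the total
  energy \<open>\<Sum>i. V (x\<^sub>i)\<close> telescope and its derivative is
  \<open>- mu * vmax\<^sup>2 * (\<Sum>i. y\<^sub>i\<^sup>2) - (\<Sum>i. q\<^sub>i * b q\<^sub>i) + q\<^sub>0 * kappa u\<^sub>y q\<^sub>0\<close> with \<open>q\<^sub>0 \<le> 0\<close>.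
  The middle sum is nonnegative, and for \<open>\<bar>u\<^sub>y\<bar> \<le> Lambda\<close> with \<open>Lambda\<close> small the last term is at most
  \<open>c * u\<^sub>y\<^sup>2\<close>: it is positive only if the drag \<open>- b q\<^sub>0\<close> is smaller than \<open>\<bar>u\<^sub>y\<bar> * vmax / 2\<close>, which forces
  \<open>q\<^sub>0\<close> to be of the order of \<open>u\<^sub>y\<close>. Integration gives the estimate. The same inequality, with the
  blow-up of \<open>Phi\<close> at \<open>L\<close> and the bounded speeds, confines solutions on bounded time intervals to the
  interior of a compact box of \<open>D\<close>, on which the right-hand side is Lipschitz; hence a solution of the system
  composed with the projection to that box never leaves it, and global existence and uniqueness follow.\<close>

section \<open>Absolutely continuous functions of one real variable\<close>

text \<open>Inputs are merely measurable, so solutions are differentiable only almost everywhere,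
  and every differential inequality (uniqueness, energy, position) is put in one form: an absolutely
  continuous function whose derivative is nonpositive almost everywhere does not increase. The
  weight \<open>vmax\<^sup>2 / 2\<close> in \<open>V\<close> cancels the factor
  \<open>1 / vmax\<^sup>2\<close> in the equation for \<open>y\<close>; since
  \<open>y * P y q = kappa y q + b q\<close>, the two equations then produce matching fluxes, and
  summation over the string leaves boundary terms only. This is why the gain does not depend on
  \<open>n\<close>. \<open>V\<close> is not coercive: \<open>Phi\<close> is zero on
  \<open>{lam..}\<close>, so the energy bounds \<open>z\<close> only from below. The right face of
  the box has to come from the speeds and moves with the time horizon. The positions in the boundary
  signals need not lie in any prescribed box. They enter through \<open>deriv Phi\<close> alone, so
  they are replaced by zero before the box argument is applied, and the original signals are
  restored afterwards.\<close>

lemma division_of_real_intervalE: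
  assumes "\<D> division_of S" and "K \<in> \<D>"
  obtains u v :: real where "u \<le> v" "K = {u..v}" "Inf K = u" "Sup K = v" "u \<in> S" "v \<in> S"
proof -
  obtain u v where K: "K = cbox u v"
    using division_ofD(4)[OF assms] by blast
  have ne: "K \<noteq> {}" and sub: "K \<subseteq> S"
    using division_ofD(2,3)[OF assms] by auto
  with K have "u \<le> v" by auto
  with K sub show ?thesis
    by (intro that[of u v]) auto
qed

text \<open>Turns the length sum in the definition of \<open>abs_continuous_on\<close> into a
  Lebesgue measure, so that an open set of small measure around the intervals controls it.\<close>

lemma division_of_total_length:
  fixes \<D> :: "real set set"
  assumes "\<D> division_of S"
  shows "S \<in> lmeasurable" "(\<Sum>K\<in>\<D>. Sup K - Inf K) = measure lebesgue S"
proof -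
  have fin: "finite \<D>" and S: "S = \<Union>\<D>"
    using division_ofD(1,6)[OF assms] by auto
  have K: "K \<in> lmeasurable \<and> Sup K - Inf K = measure lebesgue K" if "K \<in> \<D>" for K
    by (rule division_of_real_intervalE[OF assms that]) auto
  show S_meas: "S \<in> lmeasurable"
    unfolding S using fin K by (intro fmeasurable.finite_Union) auto
  have "measure lebesgue S = integral S (\<lambda>x. 1)"
    by (rule lmeasure_integral[OF S_meas])
  also have "\<dots> = (\<Sum>K\<in>\<D>. integral K (\<lambda>x. 1))"
  proof (rule integral_combine_division_bottomup[OF assms])
    show "(\<lambda>x. 1::real) integrable_on K" if "K \<in> \<D>" for K
      using K[OF that] integrable_on_const by blast
  qed
  also have "\<dots> = (\<Sum>K\<in>\<D>. Sup K - Inf K)"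
    using K by (intro sum.cong) (auto simp: lmeasure_integral)
  finally show "(\<Sum>K\<in>\<D>. Sup K - Inf K) = measure lebesgue S" by simp
qed

section \<open>Closure properties of absolute continuity\<close>

lemma abs_continuous_on_subset:
  "abs_continuous_on A g \<Longrightarrow> B \<subseteq> A \<Longrightarrow> abs_continuous_on B g"
  unfolding abs_continuous_on_def by (meson order_trans)

text \<open>The common source of the closure rules: sums, differences, inner products and Lipschitz
  images all have increments bounded by those of two absolutely continuous functions, and the bound
  can be summed over a division.\<close>

lemma abs_continuous_on_dominated:
  fixes g :: "real \<Rightarrow> 'a::real_normed_vector" and h :: "real \<Rightarrow> 'b::real_normed_vector"
    and k :: "real \<Rightarrow> 'c::real_normed_vector"
  assumes g: "abs_continuous_on A g" and h: "abs_continuous_on A h"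
    and le: "\<And>u v. u \<in> A \<Longrightarrow> v \<in> A \<Longrightarrow>
      norm (k v - k u) \<le> M * (norm (g v - g u) + norm (h v - h u))"
  shows "abs_continuous_on A k"
  unfolding abs_continuous_on_def
proof (intro allI impI)
  fix \<epsilon> :: real assume "\<epsilon> > 0"
  \<comment> \<open>The sign of \<open>M\<close> is arbitrary; \<open>M'\<close> is a strictly
    positive upper bound, by which \<open>\<epsilon>\<close> may be divided.\<close>
  define M' where "M' = max M 0 + 1"
  have M': "M' > 0" "M \<le> M'" unfolding M'_def by auto
  with \<open>\<epsilon> > 0\<close> have e': "\<epsilon> / (2 * M') > 0" by simp
  obtain d1 where d1: "d1 > 0" "\<And>\<D>. \<D> division_of \<Union>\<D> \<and> \<Union>\<D> \<subseteq> A \<and>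
      (\<Sum>k\<in>\<D>. Sup k - Inf k) < d1 \<Longrightarrow> (\<Sum>k\<in>\<D>. norm (g (Sup k) - g (Inf k))) < \<epsilon> / (2 * M')"
    using g e' unfolding abs_continuous_on_def by blast
  obtain d2 where d2: "d2 > 0" "\<And>\<D>. \<D> division_of \<Union>\<D> \<and> \<Union>\<D> \<subseteq> A \<and>
      (\<Sum>k\<in>\<D>. Sup k - Inf k) < d2 \<Longrightarrow> (\<Sum>k\<in>\<D>. norm (h (Sup k) - h (Inf k))) < \<epsilon> / (2 * M')"
    using h e' unfolding abs_continuous_on_def by blast
  show "\<exists>\<delta>>0. \<forall>\<D>. \<D> division_of \<Union>\<D> \<and> \<Union>\<D> \<subseteq> A \<and> (\<Sum>k\<in>\<D>. Sup k - Inf k) < \<delta> \<longrightarrow>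
        (\<Sum>K\<in>\<D>. norm (k (Sup K) - k (Inf K))) < \<epsilon>"
  proof (intro exI[of _ "min d1 d2"] conjI allI impI)
    show "min d1 d2 > 0" using d1 d2 by auto
    fix \<D> assume D: "\<D> division_of \<Union>\<D> \<and> \<Union>\<D> \<subseteq> A \<and> (\<Sum>k\<in>\<D>. Sup k - Inf k) < min d1 d2"
    have "norm (k (Sup K) - k (Inf K))
        \<le> M' * (norm (g (Sup K) - g (Inf K)) + norm (h (Sup K) - h (Inf K)))" if "K \<in> \<D>" for K
    proof -
      have "\<D> division_of \<Union>\<D>" using D by blast
      from this \<open>K \<in> \<D>\<close> obtain u v where "Inf K = u" "Sup K = v" "u \<in> \<Union>\<D>" "v \<in> \<Union>\<D>"
        by (rule division_of_real_intervalE)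
      then have "Inf K \<in> A" "Sup K \<in> A" using D by (metis subsetD)+
      then have "norm (k (Sup K) - k (Inf K))
          \<le> M * (norm (g (Sup K) - g (Inf K)) + norm (h (Sup K) - h (Inf K)))"
        using le by blast
      also have "\<dots> \<le> M' * (norm (g (Sup K) - g (Inf K)) + norm (h (Sup K) - h (Inf K)))"
        using M' by (intro mult_right_mono) auto
      finally show ?thesis .
    qed
    then have "(\<Sum>K\<in>\<D>. norm (k (Sup K) - k (Inf K))) \<le>
        (\<Sum>K\<in>\<D>. M' * (norm (g (Sup K) - g (Inf K)) + norm (h (Sup K) - h (Inf K))))"
      by (rule sum_mono)
    also have "\<dots> = M' * ((\<Sum>K\<in>\<D>. norm (g (Sup K) - g (Inf K)))
        + (\<Sum>K\<in>\<D>. norm (h (Sup K) - h (Inf K))))"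
      by (simp add: sum.distrib flip: sum_distrib_left)
    also have "\<dots> < M' * (\<epsilon> / (2 * M') + \<epsilon> / (2 * M'))"
      using D d1(2)[of \<D>] d2(2)[of \<D>] M' by (intro mult_strict_left_mono) auto
    also have "\<dots> = \<epsilon>" using M' by (simp add: field_simps)
    finally show "(\<Sum>K\<in>\<D>. norm (k (Sup K) - k (Inf K))) < \<epsilon>" .
  qed
qed

lemma abs_continuous_on_lipschitz_compose:
  assumes "abs_continuous_on A g" and "M-lipschitz_on B \<phi>" and "g ` A \<subseteq> B"
  shows "abs_continuous_on A (\<lambda>t. \<phi> (g t))"
proof (rule abs_continuous_on_dominated[OF assms(1) assms(1), where M = M])
  fix u v assume "u \<in> A" "v \<in> A"
  then have "norm (\<phi> (g v) - \<phi> (g u)) \<le> M * norm (g v - g u)"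
    using lipschitz_on_normD[OF assms(2)] assms(3) by blast
  then show "norm (\<phi> (g v) - \<phi> (g u)) \<le> M * (norm (g v - g u) + norm (g v - g u))"
    using mult_nonneg_nonneg[OF lipschitz_on_nonneg[OF assms(2)] norm_ge_zero[of "g v - g u"]]
    by (simp add: distrib_left)
qed

lemma lipschitz_on_imp_abs_continuous_on:
  fixes g :: "real \<Rightarrow> 'a::real_normed_vector"
  assumes "M-lipschitz_on A g"
  shows "abs_continuous_on A g"
proof -
  have id: "abs_continuous_on A (\<lambda>t::real. t)"
    unfolding abs_continuous_on_def
  proof (intro allI impI)
    fix \<epsilon> :: real assume e: "\<epsilon> > 0"
    have "(\<Sum>K\<in>\<D>. norm (Sup K - Inf K)) = (\<Sum>K\<in>\<D>. Sup K - Inf K)"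
      if "\<D> division_of \<Union>\<D>" for \<D> :: "real set set"
      by (rule sum.cong[OF refl], rule division_of_real_intervalE[OF that]) auto
    with e show "\<exists>\<delta>>0. \<forall>\<D>. \<D> division_of \<Union>\<D> \<and> \<Union>\<D> \<subseteq> A \<and> (\<Sum>k\<in>\<D>. Sup k - Inf k) < \<delta> \<longrightarrow>
        (\<Sum>k\<in>\<D>. norm (Sup k - Inf k)) < \<epsilon>"
      by (intro exI[of _ \<epsilon>]) auto
  qed
  show ?thesis
    using abs_continuous_on_lipschitz_compose[OF id assms] by simp
qed

lemma abs_continuous_on_const: "abs_continuous_on A (\<lambda>t. c)"
  by (rule lipschitz_on_imp_abs_continuous_on[OF lipschitz_on_constant])

lemma abs_continuous_on_add:
  assumes "abs_continuous_on A g" "abs_continuous_on A h"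
  shows "abs_continuous_on A (\<lambda>t. g t + h t)"
proof (rule abs_continuous_on_dominated[OF assms, where M = 1])
  show "norm (g v + h v - (g u + h u)) \<le> 1 * (norm (g v - g u) + norm (h v - h u))" for u v
    using norm_triangle_ineq[of "g v - g u" "h v - h u"] by (simp add: algebra_simps)
qed

lemma abs_continuous_on_diff:
  assumes "abs_continuous_on A g" "abs_continuous_on A h"
  shows "abs_continuous_on A (\<lambda>t. g t - h t)"
proof (rule abs_continuous_on_dominated[OF assms, where M = 1])
  show "norm (g v - h v - (g u - h u)) \<le> 1 * (norm (g v - g u) + norm (h v - h u))" for u v
    using norm_triangle_ineq4[of "g v - g u" "h v - h u"] by (simp add: algebra_simps)
qed

lemma abs_continuous_on_sum:
  assumes "\<And>i. i \<in> I \<Longrightarrow> abs_continuous_on A (g i)"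
  shows "abs_continuous_on A (\<lambda>t. \<Sum>i\<in>I. g i t)"
  using assms by (induction I rule: infinite_finite_induct)
    (auto intro: abs_continuous_on_const abs_continuous_on_add)

lemma abs_continuous_on_inner:
  fixes g h :: "real \<Rightarrow> 'a::real_inner"
  assumes "abs_continuous_on A g" "abs_continuous_on A h"
    and bg: "\<And>t. t \<in> A \<Longrightarrow> norm (g t) \<le> M" and bh: "\<And>t. t \<in> A \<Longrightarrow> norm (h t) \<le> M"
  shows "abs_continuous_on A (\<lambda>t. g t \<bullet> h t)"
proof (rule abs_continuous_on_dominated[OF assms(1,2), where M = M])
  fix u v assume uv: "u \<in> A" "v \<in> A"
  have "norm (g v \<bullet> h v - g u \<bullet> h u) = \<bar>(g v - g u) \<bullet> h v + g u \<bullet> (h v - h u)\<bar>"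
    by (simp add: inner_diff_left inner_diff_right)
  also have "\<dots> \<le> norm (g v - g u) * norm (h v) + norm (g u) * norm (h v - h u)"
    by (intro order_trans[OF abs_triangle_ineq] add_mono Cauchy_Schwarz_ineq2)
  also have "\<dots> \<le> norm (g v - g u) * M + M * norm (h v - h u)"
    using uv bg bh by (intro add_mono mult_left_mono mult_right_mono) auto
  finally show "norm (g v \<bullet> h v - g u \<bullet> h u) \<le> M * (norm (g v - g u) + norm (h v - h u))"
    by (simp add: algebra_simps)
qed

text \<open>A single interval is a division, so the definition contains uniform continuity.\<close>

lemma abs_continuous_on_imp_continuous_on:
  assumes "abs_continuous_on {a..b} g"
  shows "continuous_on {a..b} g"
  unfolding continuous_on_iff
proof (intro ballI allI impI)
  fix s \<epsilon> :: real assume s: "s \<in> {a..b}" and "\<epsilon> > 0"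
  then obtain \<delta> where "\<delta> > 0" and \<delta>: "\<And>\<D>. \<D> division_of \<Union>\<D> \<and> \<Union>\<D> \<subseteq> {a..b} \<and>
      (\<Sum>k\<in>\<D>. Sup k - Inf k) < \<delta> \<Longrightarrow> (\<Sum>k\<in>\<D>. norm (g (Sup k) - g (Inf k))) < \<epsilon>"
    using assms unfolding abs_continuous_on_def by blast
  have *: "norm (g v - g u) < \<epsilon>" if "u \<in> {a..b}" "v \<in> {a..b}" "u \<le> v" "v - u < \<delta>" for u v
  proof -
    have "{{u..v}} division_of \<Union>{{u..v}}"
      using that division_of_self[of u v] by auto
    then show ?thesis using \<delta>[of "{{u..v}}"] that by auto
  qed
  show "\<exists>d>0. \<forall>x'\<in>{a..b}. dist x' s < d \<longrightarrow> dist (g x') (g s) < \<epsilon>"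
  proof (intro exI[of _ \<delta>] conjI ballI impI)
    fix t assume "t \<in> {a..b}" "dist t s < \<delta>"
    then show "dist (g t) (g s) < \<epsilon>"
      using *[of s t] *[of t s] s by (cases "s \<le> t") (auto simp: dist_norm norm_minus_commute)
  qed fact
qed

text \<open>Take a tagged division subordinate to a gauge which forces the intervals tagged at an
  exceptional point into an open set of small measure: by absolute continuity these contribute
  little to the increment, and the others contribute little because the derivative is nonpositive.\<close>

lemma abs_continuous_on_AE_deriv_nonpos:
  fixes g :: "real \<Rightarrow> real"
  assumes ac: "abs_continuous_on {a..b} g" and "a \<le> b"
    and deriv: "AE t\<in>{a..b} in lebesgue.
      \<exists>D\<le>0. (g has_real_derivative D) (at t within {a..b})"
  shows "g b \<le> g a"
proof (rule field_le_epsilon)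
  fix e :: real assume "e > 0"
  define e' where "e' = e / (2 * (b - a + 1))"
  have e': "e' > 0" "e' * (b - a) \<le> e / 2"
    using \<open>e > 0\<close> \<open>a \<le> b\<close> unfolding e'_def by (auto simp: field_simps)
  from deriv obtain N where N: "N \<in> null_sets lebesgue" and "{t \<in> space lebesgue.
      \<not> (t \<in> {a..b} \<longrightarrow> (\<exists>D\<le>0. (g has_real_derivative D) (at t within {a..b})))} \<subseteq> N"
    unfolding eventually_ae_filter by blast
  then have der: "\<exists>D\<le>0. (g has_real_derivative D) (at t within {a..b})" if "t \<in> {a..b} - N" for t
    using that by auto
  obtain \<delta> where "\<delta> > 0" and \<delta>: "\<And>\<D>. \<D> division_of \<Union>\<D> \<and> \<Union>\<D> \<subseteq> {a..b} \<and>
      (\<Sum>k\<in>\<D>. Sup k - Inf k) < \<delta> \<Longrightarrow> (\<Sum>k\<in>\<D>. norm (g (Sup k) - g (Inf k))) < e / 2"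
    using ac \<open>e > 0\<close> unfolding abs_continuous_on_def by (meson half_gt_zero)
  obtain U where U: "open U" "N \<subseteq> U" "U - N \<in> lmeasurable"
      "emeasure lebesgue (U - N) < ennreal \<delta>"
    using sets_lebesgue_outer_open[of N \<delta>] N \<open>\<delta> > 0\<close> by auto
  have emU: "emeasure lebesgue U < ennreal \<delta>"
    using U N emeasure_Un_null_set[of "U - N" lebesgue N] by (simp add: Un_absorb2)
  have U_meas: "U \<in> lmeasurable"
    using emU U(1) by (intro fmeasurableI) (auto simp: top.not_eq_extremum intro: less_trans)
  have mU: "measure lebesgue U < \<delta>"
    using emU U_meas \<open>\<delta> > 0\<close> by (simp add: emeasure_eq_measure2 ennreal_less_iff)
  \<comment> \<open>The two sides of \<open>t\<close> are treated separately because a tag may lie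
    inside its interval; the bounds to its left and right then add up.\<close>
  have "\<exists>r>0. \<forall>s\<in>{a..b}. \<bar>s - t\<bar> < r \<longrightarrow>
      (s \<ge> t \<longrightarrow> g s - g t \<le> e' * (s - t)) \<and> (s \<le> t \<longrightarrow> g t - g s \<le> e' * (t - s))"
    if t: "t \<in> {a..b} - N" for t
  proof -
    obtain D where "D \<le> 0" and D: "(g has_real_derivative D) (at t within {a..b})"
      using der[OF t] by blast
    obtain r where "r > 0" and r: "\<And>s. s \<in> {a..b} \<Longrightarrow> \<bar>s - t\<bar> < r \<Longrightarrow>
        \<bar>g s - g t - D * (s - t)\<bar> \<le> e' * \<bar>s - t\<bar>"
      using D e'(1) unfolding has_field_derivative_def has_derivative_within_alt
      by (metis real_norm_def)
    show ?thesis
    proof (intro exI[of _ r] conjI ballI impI)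
      fix s assume s: "s \<in> {a..b}" "\<bar>s - t\<bar> < r"
      show "g s - g t \<le> e' * (s - t)" if "s \<ge> t"
        using r[OF s] that mult_nonpos_nonneg[OF \<open>D \<le> 0\<close>, of "s - t"] by auto
      show "g t - g s \<le> e' * (t - s)" if "s \<le> t"
        using r[OF s] that mult_nonpos_nonpos[OF \<open>D \<le> 0\<close>, of "s - t"] by auto
    qed fact
  qed
  then obtain r where r_pos: "\<And>t. t \<in> {a..b} - N \<Longrightarrow> r t > 0"
    and r: "\<And>t s. t \<in> {a..b} - N \<Longrightarrow> s \<in> {a..b} \<Longrightarrow> \<bar>s - t\<bar> < r t \<Longrightarrow>
      (s \<ge> t \<longrightarrow> g s - g t \<le> e' * (s - t)) \<and> (s \<le> t \<longrightarrow> g t - g s \<le> e' * (t - s))"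
    by metis
  define \<gamma> where "\<gamma> t = (if t \<in> N then U else if t \<in> {a..b} then ball t (r t) else UNIV)" for t
  have "gauge \<gamma>"
    unfolding gauge_def \<gamma>_def using U r_pos by auto
  then obtain p where p: "p tagged_division_of {a..b}" "\<gamma> fine p"
    using fine_division_exists_real by blast
  note fin = tagged_division_ofD(1)[OF p(1)]
  define p1 where "p1 = {xK \<in> p. fst xK \<in> N}"
  let ?d = "\<lambda>(x::real, K). g (Sup K) - g (Inf K)"
  have p1: "p1 tagged_division_of \<Union>(snd ` p1)"
    using tagged_partial_division_subset[of p "{a..b}" p1] p(1)
    by (intro tagged_partial_division_of_Union_self) (auto simp: tagged_division_of_def p1_def)
  then have div1: "(snd ` p1) division_of \<Union>(snd ` p1)"
    by (rule division_of_tagged_division)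
  have p_ne: "(x, {}) \<notin> p" for x
    using tagged_division_ofD(2)[OF p(1), of x "{}"] by auto
  \<comment> \<open>Passing from tagged pairs to intervals requires a summand that vanishes on every
    degenerate box. This includes the empty one, where \<open>Inf\<close> and \<open>Sup\<close>
    carry no information; hence the case distinction.\<close>
  have "sum ?d p1 = (\<Sum>(x, K)\<in>p1. if K = {} then 0 else g (Sup K) - g (Inf K))"
    using p_ne by (intro sum.cong) (auto simp: p1_def)
  also have "\<dots> = (\<Sum>K\<in>snd ` p1. if K = {} then 0 else g (Sup K) - g (Inf K))"
    by (rule sum.over_tagged_division_lemma[OF p1]) (auto simp: box_eq_empty)
  also have "\<dots> \<le> (\<Sum>K\<in>snd ` p1. norm (g (Sup K) - g (Inf K)))"
    by (intro sum_mono) auto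
  also have "\<dots> < e / 2"
  proof (rule \<delta>, intro conjI)
    have "\<Union>(snd ` p1) \<subseteq> U"
      using p(2) unfolding p1_def fine_def \<gamma>_def by fastforce
    then have "measure lebesgue (\<Union>(snd ` p1)) \<le> measure lebesgue U"
      using U_meas division_of_total_length(1)[OF div1]
      by (intro measure_mono_fmeasurable) auto
    then show "(\<Sum>k\<in>snd ` p1. Sup k - Inf k) < \<delta>"
      using mU division_of_total_length(2)[OF div1] by simp
    show "\<Union>(snd ` p1) \<subseteq> {a..b}"
      using tagged_division_ofD(3)[OF p(1)] by (fastforce simp: p1_def)
  qed fact
  finally have 1: "sum ?d p1 \<le> e / 2" by simp
  have "?d xK \<le> (\<lambda>(x, K). e' * measure lborel K) xK" if xK_in: "xK \<in> p - p1" for xK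
  proof -
    obtain x K where xK: "xK = (x, K)" by fastforce
    have inp: "(x, K) \<in> p" "x \<notin> N" using xK_in xK by (auto simp: p1_def)
    obtain u v where K: "K = {u..v}" using tagged_division_ofD(4)[OF p(1) inp(1)] by auto
    have x: "x \<in> {u..v}" "{u..v} \<subseteq> {a..b}"
      using tagged_division_ofD(2,3)[OF p(1) inp(1)] K by auto
    then have xN: "x \<in> {a..b} - N" using inp by auto
    have "{u..v} \<subseteq> ball x (r x)"
      using p(2) inp K xN unfolding fine_def \<gamma>_def by fastforce
    moreover have "u \<in> {u..v}" "v \<in> {u..v}" using x(1) by auto
    ultimately have "u \<in> ball x (r x)" "v \<in> ball x (r x)" by blast+
    then have "\<bar>u - x\<bar> < r x" "\<bar>v - x\<bar> < r x" by (auto simp: dist_real_def)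
    then have "g v - g x \<le> e' * (v - x)" "g x - g u \<le> e' * (x - u)"
      using r[OF xN, of v] r[OF xN, of u] x by auto
    then have "g v - g u \<le> e' * (v - u)" by (simp add: algebra_simps)
    then show ?thesis using xK K x(1) by auto
  qed
  then have "sum ?d (p - p1) \<le> (\<Sum>(x, K)\<in>p - p1. e' * measure lborel K)"
    by (rule sum_mono)
  also have "\<dots> \<le> (\<Sum>(x, K)\<in>p. e' * measure lborel K)"
    using fin e' by (intro sum_mono2) auto
  also have "\<dots> = e' * (\<Sum>(x, K)\<in>p. measure lborel K)"
    by (simp add: sum_distrib_left case_prod_unfold)
  also have "\<dots> = e' * (b - a)"
    using additive_content_tagged_division[of p a b] p(1) \<open>a \<le> b\<close> by simp
  finally have 2: "sum ?d (p - p1) \<le> e / 2" using e' by linarith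
  have "g b - g a = sum ?d p"
    using additive_tagged_division_1[OF \<open>a \<le> b\<close> p(1), of g] by simp
  also have "\<dots> = sum ?d (p - p1) + sum ?d p1"
    using fin by (intro sum.subset_diff) (auto simp: p1_def)
  finally show "g b \<le> g a + e" using 1 2 by linarith
qed

text \<open>A point at which the indefinite integral does not have derivative \<open>f x\<close> is an endpoint of
  arbitrarily small intervals \<open>K\<close> with \<open>norm (measure lborel K *\<^sub>R f x - integral K f) > measure lborel K / n\<close>.
  The Henstock lemma makes the total length of disjoint such intervals small, and by the Vitali
  covering theorem such intervals cover almost all exceptional points.\<close>

lemma has_vector_derivative_indefinite_integral_AE:
  fixes f :: "real \<Rightarrow> 'a::euclidean_space"
  assumes int: "f integrable_on {a..b}"
  shows "AE t\<in>{a..b} in lebesgue.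
    ((\<lambda>s. integral {a..s} f) has_vector_derivative f t) (at t within {a..b})"
proof -
  define F where "F s = integral {a..s} f" for s
  define bad where "bad k = {x\<in>{a..b}. \<forall>d>0. \<exists>y\<in>{a..b}. y \<noteq> x \<and> \<bar>y - x\<bar> < d \<and>
    norm (F y - F x - (y - x) *\<^sub>R f x) > \<bar>y - x\<bar> / Suc k}" for k
  have integral_eq: "integral {x..y} f = F y - F x" if "a \<le> x" "x \<le> y" "y \<le> b" for x y
  proof -
    have "f integrable_on {a..y}"
      using int that by (auto intro: integrable_on_subinterval)
    from Henstock_Kurzweil_Integration.integral_combine[OF that(1,2) this]
    show ?thesis by (simp add: F_def algebra_simps)
  qed
  have "negligible (bad k)" for k
    unfolding negligible_outer_le
  proof (intro allI impI)
    fix e :: real assume "e > 0"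
    \<comment> \<open>The tolerance is \<open>e / Suc k\<close> because a bad interval is shorter
      than \<open>Suc k\<close> times its error in the Henstock sum.\<close>
    obtain \<gamma> where "gauge \<gamma>" and \<gamma>: "\<And>p. p tagged_partial_division_of {a..b} \<Longrightarrow> \<gamma> fine p \<Longrightarrow>
        (\<Sum>(x, K)\<in>p. norm (measure lborel K *\<^sub>R f x - integral K f)) < e / Suc k"
      using Henstock_lemma[of f a b "e / Suc k"] int \<open>e > 0\<close> by auto
    \<comment> \<open>A pair \<open>(x, y)\<close> stands for the segment from the tag
      \<open>x\<close> to a point \<open>y\<close> that witnesses a large error. Containment in
      \<open>\<gamma> x\<close> makes every finite disjoint family of such segments fine.\<close>
    define I where "I = {(x, y). x \<in> {a..b} \<and> y \<in> {a..b} \<and> x \<noteq> y \<and>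
      closed_segment x y \<subseteq> \<gamma> x \<and> norm (F y - F x - (y - x) *\<^sub>R f x) > \<bar>y - x\<bar> / Suc k}"
    \<comment> \<open>The Vitali theorem speaks of closed balls, so a segment is described by its
      midpoint and half its length.\<close>
    define c where "c = (\<lambda>(x, y). (x + y) / 2 :: real)"
    define r where "r = (\<lambda>(x, y). \<bar>x - y\<bar> / 2 :: real)"
    have ball_eq: "cball (c (x, y)) (r (x, y)) = closed_segment x y" for x y
      unfolding c_def r_def closed_segment_eq_real_ivl cball_eq_atLeastAtMost
      by (auto simp: field_simps abs_if)
    have cover: "\<exists>i. i \<in> I \<and> x \<in> cball (c i) (r i) \<and> r i < d" if x: "x \<in> bad k" and "d > 0" for x d
    proof -
      have "open (\<gamma> x)" "x \<in> \<gamma> x" using \<open>gauge \<gamma>\<close> by (auto simp: gauge_def)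
      then obtain \<rho> where "\<rho> > 0" "ball x \<rho> \<subseteq> \<gamma> x" by (meson openE)
      moreover have "\<forall>d>0. \<exists>y\<in>{a..b}. y \<noteq> x \<and> \<bar>y - x\<bar> < d \<and>
          norm (F y - F x - (y - x) *\<^sub>R f x) > \<bar>y - x\<bar> / Suc k"
        using x unfolding bad_def by blast
      ultimately obtain y where y: "y \<in> {a..b}" "y \<noteq> x" "\<bar>y - x\<bar> < min \<rho> d"
        "norm (F y - F x - (y - x) *\<^sub>R f x) > \<bar>y - x\<bar> / Suc k"
        using \<open>d > 0\<close> by (metis min_less_iff_conj)
      have "closed_segment x y \<subseteq> ball x \<rho>"
        using y \<open>\<rho> > 0\<close> by (intro closed_segment_subset) (auto simp: dist_real_def)
      then have "(x, y) \<in> I"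
        using x y \<open>ball x \<rho> \<subseteq> \<gamma> x\<close> unfolding I_def bad_def by auto
      moreover have "r (x, y) < d" using y by (auto simp: r_def)
      ultimately show ?thesis using ball_eq[of x y] by (intro exI[of _ "(x, y)"]) auto
    qed
    have r_pos: "0 < r i" if "i \<in> I" for i
      using that by (auto simp: I_def r_def)
    obtain C where C: "countable C" "C \<subseteq> I"
      and disj: "pairwise (\<lambda>i j. disjnt (cball (c i) (r i)) (cball (c j) (r j))) C"
      and negl: "negligible (bad k - (\<Union>i\<in>C. cball (c i) (r i)))"
      by (rule Vitali_covering_theorem_cballs[of I r "bad k" c, OF r_pos cover])
    \<comment> \<open>A bound that is uniform over the finite subfamilies passes to the union over
      the countable family \<open>C\<close>.\<close>
    have bound: "measure lebesgue (\<Union>i\<in>B. cball (c i) (r i)) \<le> e" if B: "B \<subseteq> C" "finite B" for B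
    proof -
      define h where "h = (\<lambda>i. (fst i, cball (c i) (r i)) :: real \<times> real set)"
      have B_I: "i \<in> I" if "i \<in> B" for i using that B C by auto
      have h_eq: "h (x, y) = (x, closed_segment x y)" for x y
        unfolding h_def ball_eq by simp
      have part: "h ` B tagged_partial_division_of {a..b}"
        unfolding tagged_partial_division_of_def
      proof (intro conjI allI impI)
        show "finite (h ` B)" using B by simp
        fix x K assume "(x, K) \<in> h ` B"
        then obtain y where xy: "(x, y) \<in> B" "K = closed_segment x y"
          unfolding h_def ball_eq[symmetric] by force
        then have I: "x \<in> {a..b}" "y \<in> {a..b}" using B_I unfolding I_def by auto
        show "x \<in> K" using xy by simp
        show "K \<subseteq> {a..b}" using xy I by (simp add: closed_segment_subset)
        show "\<exists>a b. K = cbox a b" using xy by (auto simp: closed_segment_eq_real_ivl cbox_interval)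
      next
        fix x1 K1 x2 K2 assume *: "(x1, K1) \<in> h ` B \<and> (x2, K2) \<in> h ` B \<and> (x1, K1) \<noteq> (x2, K2)"
        then obtain i j where "i \<in> B" "j \<in> B" "(x1, K1) = h i" "(x2, K2) = h j" by blast
        with * have "K1 = cball (c i) (r i)" "K2 = cball (c j) (r j)" "i \<noteq> j" "i \<in> C" "j \<in> C"
          using B by (auto simp: h_def)
        then have "disjnt K1 K2" using disj by (simp add: pairwise_def)
        then show "interior K1 \<inter> interior K2 = {}"
          using interior_subset by (fastforce simp: disjnt_def)
      qed
      have "\<gamma> fine h ` B"
        using B_I by (force simp: fine_def h_eq I_def)
      note small = \<gamma>[OF part this]
      have ratio_le: "measure lebesgue (cball (c i) (r i)) / Suc k
          \<le> (\<lambda>(x, K). norm (measure lborel K *\<^sub>R f x - integral K f)) (h i)" if "i \<in> B" for i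
      proof -
        obtain x y where i: "i = (x, y)" by fastforce
        have I: "x \<in> {a..b}" "y \<in> {a..b}" "norm (F y - F x - (y - x) *\<^sub>R f x) > \<bar>y - x\<bar> / Suc k"
          using B_I[OF that] i unfolding I_def by auto
        have "norm (measure lborel (closed_segment x y) *\<^sub>R f x - integral (closed_segment x y) f)
            = norm (F y - F x - (y - x) *\<^sub>R f x)"
        proof (cases "x \<le> y")
          case True
          then show ?thesis using I integral_eq[of x y]
            by (simp add: closed_segment_eq_real_ivl norm_minus_commute)
        next
          case False
          then have "integral {y..x} f = F x - F y" using I integral_eq[of y x] by simp
          moreover have "norm ((x - y) *\<^sub>R f x - (F x - F y)) = norm (F y - F x - (y - x) *\<^sub>R f x)"
            by (simp add: algebra_simps)
          ultimately show ?thesis using False by (simp only: closed_segment_eq_real_ivl) simp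
        qed
        moreover have "measure lebesgue (cball (c i) (r i)) = \<bar>y - x\<bar>"
          unfolding i ball_eq by (simp add: closed_segment_eq_real_ivl)
        ultimately show ?thesis using I(3) unfolding i h_eq by simp
      qed
      have inj: "inj_on h B"
      proof (rule inj_onI, rule ccontr)
        fix i j assume *: "i \<in> B" "j \<in> B" "h i = h j" "i \<noteq> j"
        then have "disjnt (cball (c i) (r i)) (cball (c j) (r j))"
          using disj B unfolding pairwise_def by blast
        moreover have "r i > 0" using B_I[OF \<open>i \<in> B\<close>] by (auto simp: I_def r_def)
        ultimately show False using * by (auto simp: h_def disjnt_def)
      qed
      have "measure lebesgue (\<Union>i\<in>B. cball (c i) (r i)) \<le> (\<Sum>i\<in>B. measure lebesgue (cball (c i) (r i)))"
        using B by (intro measure_UNION_le) auto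
      also have "\<dots> = Suc k * (\<Sum>i\<in>B. measure lebesgue (cball (c i) (r i)) / Suc k)"
        by (simp add: sum_divide_distrib[symmetric])
      also have "\<dots> \<le> Suc k * (\<Sum>i\<in>B. (\<lambda>(x, K). norm (measure lborel K *\<^sub>R f x - integral K f)) (h i))"
        using ratio_le by (intro mult_left_mono sum_mono) auto
      also have "\<dots> = Suc k * (\<Sum>(x, K)\<in>h ` B. norm (measure lborel K *\<^sub>R f x - integral K f))"
        by (simp add: sum.reindex[OF inj])
      also have "\<dots> \<le> Suc k * (e / Suc k)"
        using small by (intro mult_left_mono) auto
      finally show ?thesis by simp
    qed
    define T where "T = (bad k - (\<Union>i\<in>C. cball (c i) (r i))) \<union> (\<Union>i\<in>C. cball (c i) (r i))"
    have U: "(\<Union>i\<in>C. cball (c i) (r i)) \<in> lmeasurable"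
      "measure lebesgue (\<Union>i\<in>C. cball (c i) (r i)) \<le> e"
      using fmeasurable_UN_bound[OF C(1) _ bound] measure_UN_bound[OF C(1) _ bound] by auto
    have null: "bad k - (\<Union>i\<in>C. cball (c i) (r i)) \<in> null_sets lebesgue"
      using negl negligible_iff_null_sets by blast
    have "measure lebesgue T \<le> e"
      unfolding T_def using U null measure_Un_null_set[of _ lebesgue]
      by (metis Un_commute fmeasurableD)
    moreover have "T \<in> lmeasurable"
      unfolding T_def using U negl
      by (intro fmeasurable.Un) (auto intro: negligible_imp_measurable)
    ultimately show "\<exists>T. bad k \<subseteq> T \<and> T \<in> lmeasurable \<and> measure lebesgue T \<le> e"
      by (intro exI[of _ T]) (auto simp: T_def)
  qed
  then have "negligible (\<Union>k. bad k)" by (rule negligible_Union_nat)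
  then have null: "(\<Union>k. bad k) \<in> null_sets lebesgue" by (simp add: negligible_iff_null_sets)
  have "(F has_vector_derivative f t) (at t within {a..b})" if t: "t \<in> {a..b}" "t \<notin> (\<Union>k. bad k)" for t
    unfolding has_vector_derivative_def has_derivative_within_alt
  proof (intro conjI allI impI)
    show "bounded_linear (\<lambda>x. x *\<^sub>R f t)" by (rule bounded_linear_scaleR_left)
    fix \<epsilon> :: real assume "\<epsilon> > 0"
    then obtain k where k: "1 / Suc k < \<epsilon>" using nat_approx_posE by metis
    have "t \<notin> bad k" using t by auto
    then have "\<exists>d>0. \<forall>y\<in>{a..b}. y \<noteq> t \<longrightarrow> \<bar>y - t\<bar> < d \<longrightarrow>
        norm (F y - F t - (y - t) *\<^sub>R f t) \<le> \<bar>y - t\<bar> / Suc k"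
      using t(1) unfolding bad_def by (simp add: not_less) (meson not_less)
    then obtain d where d: "d > 0" "\<And>y. y \<in> {a..b} \<Longrightarrow> y \<noteq> t \<Longrightarrow> \<bar>y - t\<bar> < d \<Longrightarrow>
        norm (F y - F t - (y - t) *\<^sub>R f t) \<le> \<bar>y - t\<bar> / Suc k"
      by blast
    have "norm (F y - F t - (y - t) *\<^sub>R f t) \<le> \<epsilon> * norm (y - t)"
      if y: "y \<in> {a..b}" "norm (y - t) < d" for y
    proof (cases "y = t")
      case False
      then have "norm (F y - F t - (y - t) *\<^sub>R f t) \<le> (1 / Suc k) * \<bar>y - t\<bar>"
        using d(2)[of y] y by simp
      also have "\<dots> \<le> \<epsilon> * \<bar>y - t\<bar>" using k by (intro mult_right_mono) auto
      finally show ?thesis by simp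
    qed simp
    then show "\<exists>d>0. \<forall>y\<in>{a..b}. norm (y - t) < d \<longrightarrow>
        norm (F y - F t - (y - t) *\<^sub>R f t) \<le> \<epsilon> * norm (y - t)"
      using d(1) by blast
  qed
  then have "{t. \<not> (t \<in> {a..b} \<longrightarrow> (F has_vector_derivative f t) (at t within {a..b}))} \<subseteq> (\<Union>k. bad k)"
    by blast
  with null show ?thesis
    unfolding F_def[abs_def] by (auto intro: AE_I' simp: F_def)
qed

section \<open>Existence of Caratheodory solutions\<close>

lemma integrable_on_bounded_measurable:
  fixes f :: "real \<Rightarrow> 'a::euclidean_space"
  assumes f: "f \<in> borel_measurable (lebesgue_on {0..})" and B: "\<And>t. t \<ge> 0 \<Longrightarrow> norm (f t) \<le> B"
    and "0 \<le> a"
  shows "f integrable_on {a..b}"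
proof (rule measurable_bounded_by_integrable_imp_integrable)
  show "f \<in> borel_measurable (lebesgue_on {a..b})"
    using f by (rule measurable_restrict_mono) (use \<open>0 \<le> a\<close> in auto)
  show "(\<lambda>t. B) integrable_on {a..b}" by auto
qed (use B \<open>0 \<le> a\<close> in auto)

lemma lipschitz_on_indefinite_integral:
  fixes f :: "real \<Rightarrow> 'a::euclidean_space"
  assumes int: "f integrable_on {a..b}" and B: "\<And>t. t \<in> {a..b} \<Longrightarrow> norm (f t) \<le> B" and "0 \<le> B"
  shows "B-lipschitz_on {a..b} (\<lambda>t. integral {a..t} f)"
proof (rule lipschitz_on_leI)
  fix s t :: real assume "s \<in> {a..b}" "t \<in> {a..b}" "s \<le> t"
  then have st: "a \<le> s" "s \<le> t" "t \<le> b" by auto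
  have "f integrable_on {a..t}"
    using int st by (auto intro: integrable_on_subinterval)
  then have "integral {a..t} f - integral {a..s} f = integral {s..t} f"
    using Henstock_Kurzweil_Integration.integral_combine[OF st(1,2), of f] by (simp add: algebra_simps)
  moreover have "f integrable_on {s..t}"
    using int st by (auto intro: integrable_on_subinterval)
  then have "norm (integral {s..t} f) \<le> B * (t - s)"
    using integrable_bound[of B f s t] B st \<open>0 \<le> B\<close> by auto
  ultimately show "dist (integral {a..s} f) (integral {a..t} f) \<le> B * dist s t"
    using st by (simp add: dist_norm norm_minus_commute[of "integral {a..s} f" "integral {a..t} f"])
qed fact

lemma lipschitz_on_indefinite_integral_Ici:
  fixes f :: "real \<Rightarrow> 'a::euclidean_space"
  assumes int: "\<And>b. f integrable_on {0..b}" and B: "\<And>t. t \<ge> 0 \<Longrightarrow> norm (f t) \<le> B"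
  shows "B-lipschitz_on {0..} (\<lambda>t. integral {0..t} f)"
proof (rule lipschitz_onI)
  show B0: "0 \<le> B" using B[of 0] norm_ge_zero order_trans by blast
  fix s t :: real assume "s \<in> {0..}" "t \<in> {0..}"
  then show "dist (integral {0..s} f) (integral {0..t} f) \<le> B * dist s t"
    by (intro lipschitz_onD[OF lipschitz_on_indefinite_integral[OF int, of "max s t"]]) (use B B0 in auto)
qed

lemma at_within_Icc_eq_at_within_Ici:
  fixes t T :: real
  assumes "t < T"
  shows "at t within {0..T} = at t within {0..}"
  by (rule at_within_nhd[of _ "{..<T}"]) (use assms in auto)

text \<open>The half line is exhausted by \<open>{0..k}\<close>. For \<open>t < k\<close> the
  derivative within \<open>{0..k}\<close> is the derivative within \<open>{0..}\<close>, and
  countably many null sets are discarded.\<close>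

lemma has_vector_derivative_indefinite_integral_AE_Ici:
  fixes f :: "real \<Rightarrow> 'a::euclidean_space"
  assumes int: "\<And>b. f integrable_on {0..b}"
  shows "AE t\<in>{0..} in lebesgue.
    ((\<lambda>s. integral {0..s} f) has_vector_derivative f t) (at t within {0..})"
proof -
  have "AE t in lebesgue. \<forall>k::nat. t \<in> {0..real k} \<longrightarrow>
      ((\<lambda>s. integral {0..s} f) has_vector_derivative f t) (at t within {0..real k})"
    using has_vector_derivative_indefinite_integral_AE[OF int] by (simp add: AE_all_countable)
  then show ?thesis
  proof eventually_elim
    case (elim t)
    show ?case
    proof
      assume "t \<in> {0..}"
      obtain k :: nat where "t < real k" using reals_Archimedean2 by blast
      moreover from this have "t \<in> {0..real k}" using \<open>t \<in> {0..}\<close> by simp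
      then have "((\<lambda>s. integral {0..s} f) has_vector_derivative f t) (at t within {0..real k})"
        using elim by blast
      ultimately show "((\<lambda>s. integral {0..s} f) has_vector_derivative f t) (at t within {0..})"
        by (simp only: at_within_Icc_eq_at_within_Ici)
    qed
  qed
qed

lemma has_integral_exp_scaled:
  fixes M t :: real
  assumes "M \<noteq> 0" "t \<ge> 0"
  shows "((\<lambda>s. c * exp (M * s)) has_integral c * (exp (M * t) - 1) / M) {0..t}"
proof -
  have "((\<lambda>s. c * exp (M * s)) has_integral (c / M * exp (M * t) - c / M * exp (M * 0))) {0..t}"
  proof (rule fundamental_theorem_of_calculus[OF \<open>t \<ge> 0\<close>])
    show "((\<lambda>s. c / M * exp (M * s)) has_vector_derivative c * exp (M * s)) (at s within {0..t})" for s
      unfolding has_real_derivative_iff_has_vector_derivative[symmetric]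
      by (rule derivative_eq_intros refl | use \<open>M \<noteq> 0\<close> in simp)+
  qed
  then show ?thesis by (simp add: algebra_simps diff_divide_distrib)
qed

text \<open>The integral operator is a contraction for the norm \<open>sup (exp (- m * t) * norm (x i t))\<close> with
  \<open>m\<close> large. A family \<open>x i t\<close> is encoded as a bounded continuous function of \<open>(real i, t)\<close>, with
  piecewise linear interpolation in the first argument.\<close>

lemma picard_global:
  fixes F :: "nat \<Rightarrow> real \<Rightarrow> (nat \<Rightarrow> 'a::euclidean_space) \<Rightarrow> 'a"
  assumes "finite I"
    and meas: "\<And>i x. i \<in> I \<Longrightarrow> (\<And>j. continuous_on {0..} (x j)) \<Longrightarrow>
      (\<lambda>t. F i t (\<lambda>j. x j t)) \<in> borel_measurable (lebesgue_on {0..})"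
    and bound: "\<And>i t x. i \<in> I \<Longrightarrow> t \<ge> 0 \<Longrightarrow> norm (F i t x) \<le> B"
    and lip: "\<And>i t x y d. i \<in> I \<Longrightarrow> t \<ge> 0 \<Longrightarrow> d \<ge> 0 \<Longrightarrow> (\<And>j. j \<in> I \<Longrightarrow> norm (x j - y j) \<le> d) \<Longrightarrow>
      norm (F i t x - F i t y) \<le> M * d"
  obtains x :: "nat \<Rightarrow> real \<Rightarrow> 'a" where "\<And>i. continuous_on {0..} (x i)"
    and "\<And>i t. i \<in> I \<Longrightarrow> t \<ge> 0 \<Longrightarrow> x i t = \<xi> i + integral {0..t} (\<lambda>s. F i s (\<lambda>j. x j s))"
proof (cases "I = {}")
  case True
  show ?thesis by (rule that[of "\<lambda>i t. 0"]) (use True in auto)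
next
  case False
  then obtain i0 where i0: "i0 \<in> I" by blast
  have B0: "B \<ge> 0" using bound[OF i0, of 0] norm_ge_zero order_trans by blast
  have M0: "M \<ge> 0" using lip[OF i0, of 0 1 "\<lambda>j. 0" "\<lambda>j. 0"] by simp
  \<comment> \<open>The weight gains a factor \<open>M / m\<close> per component and the
    interpolated sum costs at most \<open>card I\<close>; this \<open>m\<close> keeps the product
    below \<open>1 / 2\<close>, and the summand 1 keeps \<open>m\<close> positive when
    \<open>M = 0\<close>.\<close>
  define m where "m = 2 * card I * M + 1"
  have m: "m > 0" "card I * (M / m) \<le> 1 / 2" using M0 unfolding m_def by (auto simp: field_simps add_pos_nonneg)
  define hat where "hat x = max 0 (1 - \<bar>x\<bar>)" for x :: real
  have hat: "0 \<le> hat x" "hat x \<le> 1" for x by (auto simp: hat_def)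
  have hat_nat: "hat (real j - real i) = (if i = j then 1 else 0)" for i j
    by (auto simp: hat_def)
  define X :: "((real \<times> real) \<Rightarrow>\<^sub>C 'a) \<Rightarrow> nat \<Rightarrow> real \<Rightarrow> 'a"
    where "X \<phi> j s = exp (m * s) *\<^sub>R apply_bcontfun \<phi> (real j, s)" for \<phi> j s
  define J where "J \<phi> i t = integral {0..t} (\<lambda>s. F i s (\<lambda>j. X \<phi> j s))" for \<phi> i t
  \<comment> \<open>\<open>max t 0\<close> extends the family to negative times, since the Banach
    space consists of functions on the whole plane.\<close>
  define g where "g \<phi> i t = exp (- m * max t 0) *\<^sub>R (\<xi> i + J \<phi> i (max t 0))" for \<phi> i t
  define G where "G \<phi> p = (\<Sum>i\<in>I. hat (fst p - real i) *\<^sub>R g \<phi> i (snd p))" for \<phi> and p :: "real \<times> real"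
  have X_cont: "continuous_on A (X \<phi> j)" for \<phi> j A
    unfolding X_def
    by (intro continuous_intros continuous_on_compose2[OF continuous_on_apply_bcontfun[of UNIV \<phi>]]) auto
  have int: "(\<lambda>s. F i s (\<lambda>j. X \<phi> j s)) integrable_on {0..t}" if "i \<in> I" for i \<phi> t
    by (rule integrable_on_bounded_measurable[OF meas[OF that X_cont] bound[OF that]]) auto
  have J_lip: "B-lipschitz_on {0..} (J \<phi> i)" if "i \<in> I" for i \<phi>
    unfolding J_def[abs_def] by (rule lipschitz_on_indefinite_integral_Ici[OF int[OF that] bound[OF that]])
  have g_bound: "norm (g \<phi> i t) \<le> norm (\<xi> i) + B / m" if "i \<in> I" for \<phi> i t
  proof -
    define s where "s = max t 0"
    have s: "s \<ge> 0" by (simp add: s_def)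
    have "norm (J \<phi> i s - J \<phi> i 0) \<le> B * norm (s - 0)"
      by (rule lipschitz_on_normD[OF J_lip[OF that]]) (use s in auto)
    then have Js: "norm (J \<phi> i s) \<le> B * s" using s by (simp add: J_def)
    \<comment> \<open>The integral grows at most linearly in time, and the exponential weight
      absorbs this growth, so the encoded function is bounded.\<close>
    have "m * s \<le> exp (m * s)" using exp_ge_add_one_self[of "m * s"] by linarith
    then have exp_s: "exp (- m * s) * s \<le> 1 / m"
      using m by (simp add: exp_minus field_simps)
    have "norm (g \<phi> i t) = exp (- m * s) * norm (\<xi> i + J \<phi> i s)"
      by (simp add: g_def s_def)
    also have "\<dots> \<le> exp (- m * s) * (norm (\<xi> i) + B * s)"
      using Js by (intro mult_left_mono order_trans[OF norm_triangle_ineq]) auto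
    also have "\<dots> = exp (- m * s) * norm (\<xi> i) + B * (exp (- m * s) * s)"
      by (simp add: algebra_simps)
    also have "\<dots> \<le> 1 * norm (\<xi> i) + B * (1 / m)"
      using exp_s m s B0 by (intro add_mono mult_mono mult_left_mono) auto
    finally show ?thesis by simp
  qed
  have G_bcontfun: "G \<phi> \<in> bcontfun" for \<phi>
  proof (rule bcontfun_normI)
    have g_cont: "continuous_on UNIV (\<lambda>p. g \<phi> i (snd p))" if "i \<in> I" for i
      unfolding g_def
      by (intro continuous_intros continuous_on_compose2[OF lipschitz_on_continuous_on[OF J_lip[OF that]]])
        auto
    show "continuous_on UNIV (G \<phi>)"
      unfolding G_def hat_def by (intro continuous_intros g_cont)
    fix p :: "real \<times> real"
    have "norm (hat (fst p - real i) *\<^sub>R g \<phi> i (snd p)) \<le> 1 * (norm (\<xi> i) + B / m)" if "i \<in> I" for i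
      unfolding norm_scaleR using hat g_bound[OF that] by (intro mult_mono) auto
    then show "norm (G \<phi> p) \<le> (\<Sum>i\<in>I. norm (\<xi> i) + B / m)"
      unfolding G_def by (intro sum_norm_le) auto
  qed
  define \<Psi> where "\<Psi> \<phi> = Bcontfun (G \<phi>)" for \<phi>
  have \<Psi>: "apply_bcontfun (\<Psi> \<phi>) = G \<phi>" for \<phi>
    unfolding \<Psi>_def using G_bcontfun by (simp add: Bcontfun_inverse)
  have g_diff: "norm (g \<phi> i t - g \<psi> i t) \<le> M / m * dist \<phi> \<psi>" if "i \<in> I" for \<phi> \<psi> i t
  proof -
    define s where "s = max t 0"
    have s: "s \<ge> 0" by (simp add: s_def)
    let ?H = "\<lambda>r. F i r (\<lambda>j. X \<phi> j r) - F i r (\<lambda>j. X \<psi> j r)"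
    have H: "norm (?H r) \<le> (M * dist \<phi> \<psi>) * exp (m * r)" if "r \<in> {0..s}" for r
    proof -
      have "norm (X \<phi> j r - X \<psi> j r) \<le> dist \<phi> \<psi> * exp (m * r)" for j
      proof -
        have "norm (X \<phi> j r - X \<psi> j r)
            = exp (m * r) * dist (apply_bcontfun \<phi> (j, r)) (apply_bcontfun \<psi> (j, r))"
          by (simp add: X_def dist_norm flip: scaleR_diff_right)
        then show ?thesis using dist_bounded[of \<phi> "(j, r)" \<psi>] by (simp add: mult.commute)
      qed
      with lip[of i r "dist \<phi> \<psi> * exp (m * r)" "\<lambda>j. X \<phi> j r" "\<lambda>j. X \<psi> j r", OF \<open>i \<in> I\<close>] that
      show ?thesis by (simp add: mult_ac)
    qed
    have "norm (integral {0..s} ?H) \<le> integral {0..s} (\<lambda>r. (M * dist \<phi> \<psi>) * exp (m * r))"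
      using has_integral_exp_scaled[of m s "M * dist \<phi> \<psi>"] m s
      by (intro integral_norm_bound_integral integrable_diff int[OF that] H) auto
    also have "\<dots> = M * dist \<phi> \<psi> * (exp (m * s) - 1) / m"
      using has_integral_exp_scaled[of m s "M * dist \<phi> \<psi>"] m s by (intro integral_unique) auto
    also have "\<dots> \<le> M * dist \<phi> \<psi> * exp (m * s) / m"
      using m M0 by (intro divide_right_mono mult_left_mono mult_nonneg_nonneg) auto
    finally have "norm (J \<phi> i s - J \<psi> i s) \<le> M / m * dist \<phi> \<psi> * exp (m * s)"
      unfolding J_def using integral_diff[OF int[OF that] int[OF that]] by simp
    then have "exp (- m * s) * norm (J \<phi> i s - J \<psi> i s)
        \<le> exp (- m * s) * (M / m * dist \<phi> \<psi> * exp (m * s))"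
      by (intro mult_left_mono) auto
    also have "\<dots> = M / m * dist \<phi> \<psi>" by (simp add: exp_minus)
    finally show ?thesis
      by (simp add: g_def s_def flip: scaleR_diff_right)
  qed
  have contraction: "dist (\<Psi> \<phi>) (\<Psi> \<psi>) \<le> 1 / 2 * dist \<phi> \<psi>" for \<phi> \<psi>
  proof (rule dist_bound)
    fix p :: "real \<times> real"
    have "norm (hat (fst p - real i) *\<^sub>R (g \<phi> i (snd p) - g \<psi> i (snd p))) \<le> 1 * (M / m * dist \<phi> \<psi>)"
      if "i \<in> I" for i
      unfolding norm_scaleR using hat g_diff[OF that] by (intro mult_mono) auto
    then have "norm (G \<phi> p - G \<psi> p) \<le> (\<Sum>i\<in>I. M / m * dist \<phi> \<psi>)"
      unfolding G_def by (simp only: sum_subtractf[symmetric] scaleR_diff_right[symmetric])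
        (intro sum_norm_le, auto)
    also have "\<dots> = card I * (M / m) * dist \<phi> \<psi>" by simp
    also have "\<dots> \<le> 1 / 2 * dist \<phi> \<psi>" using m by (intro mult_right_mono) auto
    finally show "dist (apply_bcontfun (\<Psi> \<phi>) p) (apply_bcontfun (\<Psi> \<psi>) p) \<le> 1 / 2 * dist \<phi> \<psi>"
      by (simp add: \<Psi> dist_norm)
  qed
  have "\<exists>!\<phi>. \<Psi> \<phi> = \<phi>"
    by (rule banach_fix_type[where c = "1 / 2" and f = \<Psi>]) (use contraction in auto)
  then obtain \<phi> where \<phi>: "\<Psi> \<phi> = \<phi>" by blast
  have "X \<phi> i t = \<xi> i + J \<phi> i t" if "i \<in> I" "t \<ge> 0" for i t
  proof -
    have "apply_bcontfun \<phi> (real i, t) = (\<Sum>j\<in>I. if j = i then g \<phi> j t else 0)"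
      using \<Psi>[of \<phi>] by (simp add: \<phi> G_def hat_nat if_distrib[of "\<lambda>c. c *\<^sub>R _"] cong: if_cong)
    also have "\<dots> = exp (- m * t) *\<^sub>R (\<xi> i + J \<phi> i t)"
      using that \<open>finite I\<close> by (simp add: g_def)
    finally show ?thesis by (simp add: X_def exp_minus)
  qed
  then show ?thesis using that[of "X \<phi>"] X_cont by (simp add: J_def)
qed

lemma dist_triple_le:
  "dist (a, b, c) (a', b', c') \<le> dist a a' + (dist b b' + dist c c')"
proof -
  have "dist (a, b, c) (a', b', c') \<le> dist a a' + dist (b, c) (b', c')"
    by (simp only: dist_Pair_Pair[of a "(b, c)"] sqrt_sum_squares_le_sum zero_le_dist)
  moreover have "dist (b, c) (b', c') \<le> dist b b' + dist c c'"
    by (simp only: dist_Pair_Pair sqrt_sum_squares_le_sum zero_le_dist)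
  ultimately show ?thesis by simp
qed

text \<open>A fixed point of the integral equation is a Caratheodory solution: boundedness of
  \<open>g\<close> makes it Lipschitz in time, hence absolutely continuous, and the indefinite
  integral is differentiable almost everywhere.\<close>

lemma string_solution_exists_lipschitz:
  fixes g :: "'a::euclidean_space \<Rightarrow> 'a \<Rightarrow> 'a \<Rightarrow> 'a"
  assumes lip: "M-lipschitz_on UNIV (\<lambda>(a, b, c). g a b c)"
    and bound: "\<And>a b c. norm (g a b c) \<le> B"
    and u: "u \<in> borel_measurable (lebesgue_on {0..})"
    and w: "w \<in> borel_measurable (lebesgue_on {0..})"
    and \<xi>: "\<xi> \<in> states UNIV n"
  shows "\<exists>x. string_solution g UNIV n u w {0..} x \<and> x 0 = \<xi>"
proof -
  let ?I = "{1..n}"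
  define Y where "Y t = with_boundary n (u t) (w t)" for t
  define F where "F i t x = g (Y t x (i - 1)) (Y t x i) (Y t x (i + 1))" for i t x
  have cont: "continuous_on UNIV (\<lambda>(a, b, c). g a b c)"
    by (rule lipschitz_on_continuous_on[OF lip])
  have F_meas: "(\<lambda>t. F i t (\<lambda>j. x j t)) \<in> borel_measurable (lebesgue_on {0..})"
    if x: "\<And>j. continuous_on {0..} (x j)" for i x
  proof -
    have Y: "(\<lambda>t. Y t (\<lambda>j. x j t) k) \<in> borel_measurable (lebesgue_on {0..})" for k
    proof -
      have "x k \<in> borel_measurable (lebesgue_on {0..})"
        using x by (intro continuous_imp_measurable_on_sets_lebesgue) auto
      then show ?thesis
        unfolding Y_def with_boundary_def using u w by (cases "k = Suc n"; cases "k = 0") auto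
    qed
    have "(\<lambda>t. (\<lambda>(a, b, c). g a b c)
        (Y t (\<lambda>j. x j t) (i - 1), Y t (\<lambda>j. x j t) i, Y t (\<lambda>j. x j t) (i + 1)))
        \<in> borel_measurable (lebesgue_on {0..})"
      by (rule measurable_compose[OF borel_measurable_Pair[OF Y borel_measurable_Pair[OF Y Y]]])
        (rule borel_measurable_continuous_onI[OF cont])
    then show ?thesis by (simp add: F_def)
  qed
  have F_lip: "norm (F i t x - F i t y) \<le> (3 * M) * d"
    if "i \<in> ?I" "d \<ge> 0" and xy: "\<And>j. j \<in> ?I \<Longrightarrow> norm (x j - y j) \<le> d" for i t x y d
  proof -
    have Y: "dist (Y t x k) (Y t y k) \<le> d" if "k \<le> Suc n" for k
      using that xy[of k] \<open>d \<ge> 0\<close> by (auto simp: Y_def with_boundary_def dist_norm)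
    have "norm (F i t x - F i t y) \<le> M * dist (Y t x (i - 1), Y t x i, Y t x (i + 1))
        (Y t y (i - 1), Y t y i, Y t y (i + 1))"
      using lipschitz_onD[OF lip, of "(Y t x (i - 1), Y t x i, Y t x (i + 1))"
        "(Y t y (i - 1), Y t y i, Y t y (i + 1))"] by (simp add: F_def dist_norm)
    also have "\<dots> \<le> M * (d + (d + d))"
      using Y \<open>i \<in> ?I\<close> lipschitz_on_nonneg[OF lip]
      by (intro mult_left_mono order_trans[OF dist_triple_le] add_mono) auto
    finally show ?thesis by simp
  qed
  have F_bound: "norm (F i t x) \<le> B" for i t x
    by (simp add: F_def bound)
  obtain X where X_cont: "\<And>i. continuous_on {0..} (X i)"
    and X: "\<And>i t. i \<in> ?I \<Longrightarrow> t \<ge> 0 \<Longrightarrow> X i t = \<xi> i + integral {0..t} (\<lambda>s. F i s (\<lambda>j. X j s))"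
    by (rule picard_global[of ?I F B "3 * M" \<xi>]) (auto intro!: F_meas F_lip F_bound)
  \<comment> \<open>States are extensional, so the irrelevant components are cut off. For
    \<open>i\<close> in \<open>{1..n}\<close> the right-hand side does not see this, because the
    indices \<open>0\<close> and \<open>Suc n\<close> are overwritten by the boundary
    signals.\<close>
  define x where "x t = restrict (\<lambda>i. X i t) ?I" for t
  have F_x: "F i t (\<lambda>j. X j t) = F i t (x t)" if "i \<in> ?I" for i t
    using that by (auto simp: F_def Y_def with_boundary_def x_def)
  have F_int: "(\<lambda>s. F i s (\<lambda>j. X j s)) integrable_on {0..t}" for i t
    by (rule integrable_on_bounded_measurable[OF F_meas[OF X_cont] F_bound]) auto
  have lip_X: "B-lipschitz_on {0..} (\<lambda>t. integral {0..t} (\<lambda>s. F i s (\<lambda>j. X j s)))" for i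
    by (rule lipschitz_on_indefinite_integral_Ici[OF F_int F_bound])
  have "string_solution g UNIV n u w {0..} x"
    unfolding string_solution_def
  proof (intro conjI ballI)
    show "x t \<in> states UNIV n" for t
      by (simp add: x_def states_def)
  next
    fix i assume i: "i \<in> ?I"
    have "(0 + B)-lipschitz_on {0..} (\<lambda>t. \<xi> i + integral {0..t} (\<lambda>s. F i s (\<lambda>j. X j s)))"
      by (intro lipschitz_on_add lipschitz_on_constant lip_X)
    then have "(0 + B)-lipschitz_on {0..} (\<lambda>t. x t i)"
      by (rule lipschitz_on_transform) (use X i in \<open>auto simp: x_def\<close>)
    then show "locally_abs_continuous_on {0..} (\<lambda>t. x t i)"
      unfolding locally_abs_continuous_on_def
      by (intro allI impI) (rule lipschitz_on_imp_abs_continuous_on[OF lipschitz_on_subset])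
  next
    have "AE t in lebesgue. \<forall>i\<in>?I. t \<in> {0..} \<longrightarrow>
      ((\<lambda>s. integral {0..s} (\<lambda>s. F i s (\<lambda>j. X j s))) has_vector_derivative F i t (\<lambda>j. X j t))
        (at t within {0..})"
      by (intro AE_finite_allI has_vector_derivative_indefinite_integral_AE_Ici F_int) auto
    then show "AE t\<in>{0..} in lebesgue. \<forall>i\<in>?I. let X = with_boundary n (u t) (w t) (x t)
      in ((\<lambda>s. x s i) has_vector_derivative g (X (i - 1)) (X i) (X (i + 1))) (at t within {0..})"
    proof eventually_elim
      case (elim t)
      show ?case
      proof (intro impI ballI)
        fix i assume t: "t \<in> {0..}" and i: "i \<in> ?I"
        have "((\<lambda>s. integral {0..s} (\<lambda>s. F i s (\<lambda>j. X j s))) has_vector_derivative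
            F i t (\<lambda>j. X j t)) (at t within {0..})"
          using elim t i by blast
        from has_vector_derivative_add[OF has_vector_derivative_const[of "\<xi> i"] this]
        have "((\<lambda>s. \<xi> i + integral {0..s} (\<lambda>s. F i s (\<lambda>j. X j s))) has_vector_derivative
            F i t (\<lambda>j. X j t)) (at t within {0..})"
          by simp
        then have "((\<lambda>s. x s i) has_vector_derivative F i t (\<lambda>j. X j t)) (at t within {0..})"
          by (rule has_vector_derivative_transform[OF t, rotated]) (use X i in \<open>auto simp: x_def\<close>)
        then show "let X = with_boundary n (u t) (w t) (x t)
          in ((\<lambda>s. x s i) has_vector_derivative g (X (i - 1)) (X i) (X (i + 1))) (at t within {0..})"
          unfolding F_x[OF i] by (simp add: F_def Y_def Let_def)
      qed
    qed
  qed
  moreover have "x 0 = \<xi>"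
  proof
    fix i show "x 0 i = \<xi> i"
      using X[of i 0] \<xi> PiE_arb[of \<xi> ?I _ i] by (cases "i \<in> ?I") (auto simp: x_def states_def)
  qed
  ultimately show ?thesis by blast
qed

section \<open>Uniqueness and continuation\<close>

lemma abs_continuous_on_cong:
  assumes "abs_continuous_on A g" "\<And>t. t \<in> A \<Longrightarrow> h t = g t"
  shows "abs_continuous_on A h"
  by (rule abs_continuous_on_dominated[OF assms(1) assms(1), where M = 1]) (use assms(2) in auto)

lemma abs_continuous_on_Icc_inner:
  fixes g h :: "real \<Rightarrow> 'a::real_inner"
  assumes "abs_continuous_on {a..b} g" "abs_continuous_on {a..b} h"
  shows "abs_continuous_on {a..b} (\<lambda>t. g t \<bullet> h t)"
proof -
  have "bounded (k ` {a..b})" if "abs_continuous_on {a..b} k" for k :: "real \<Rightarrow> 'a"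
    using that by (intro compact_imp_bounded compact_continuous_image
      abs_continuous_on_imp_continuous_on compact_Icc)
  then obtain M N where "\<forall>t\<in>{a..b}. norm (g t) \<le> M" "\<forall>t\<in>{a..b}. norm (h t) \<le> N"
    using assms by (force simp: bounded_iff)
  then have "norm (g t) \<le> max M N" "norm (h t) \<le> max M N" if "t \<in> {a..b}" for t
    using that by (auto simp: le_max_iff_disj)
  with assms show ?thesis by (rule abs_continuous_on_inner)
qed

lemma C1_imp_lipschitz_on_Icc:
  fixes \<phi> :: "real \<Rightarrow> real"
  assumes der: "\<And>x. x \<in> {a..b} \<Longrightarrow> (\<phi> has_real_derivative \<phi>' x) (at x)"
    and cont: "continuous_on {a..b} \<phi>'"
  obtains M where "M-lipschitz_on {a..b} \<phi>"
proof -
  have "bounded (\<phi>' ` {a..b})"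
    by (intro compact_imp_bounded compact_continuous_image cont compact_Icc)
  then obtain M where M: "\<And>x. x \<in> {a..b} \<Longrightarrow> \<bar>\<phi>' x\<bar> \<le> M"
    unfolding bounded_iff by fastforce
  have "(max M 0)-lipschitz_on {a..b} \<phi>"
  proof (rule bounded_derivative_imp_lipschitz)
    fix x assume x: "x \<in> {a..b}"
    show "(\<phi> has_derivative (*) (\<phi>' x)) (at x within {a..b})"
      using der[OF x] by (simp add: has_field_derivative_def has_derivative_at_withinI)
    show "onorm ((*) (\<phi>' x)) \<le> max M 0"
      using M[OF x] by (intro onorm_bound) (auto simp: abs_mult intro!: mult_right_mono)
  qed auto
  then show ?thesis by (rule that)
qed

lemma string_solution_in_domain:
  "string_solution f D n u w J x \<Longrightarrow> t \<in> J \<Longrightarrow> i \<in> {1..n} \<Longrightarrow> x t i \<in> D"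
  unfolding string_solution_def states_def by blast

lemma string_solution_subset:
  assumes sol: "string_solution f D n u w J x" and sub: "J' \<subseteq> J"
  shows "string_solution f D n u w J' x"
proof -
  have "AE t\<in>J in lebesgue. \<forall>i\<in>{1..n}. let X = with_boundary n (u t) (w t) (x t)
      in ((\<lambda>s. x s i) has_vector_derivative f (X (i - 1)) (X i) (X (i + 1))) (at t within J)"
    using sol by (simp add: string_solution_def)
  then have "AE t\<in>J' in lebesgue. \<forall>i\<in>{1..n}. let X = with_boundary n (u t) (w t) (x t)
      in ((\<lambda>s. x s i) has_vector_derivative f (X (i - 1)) (X i) (X (i + 1))) (at t within J')"
    by eventually_elim
      (use sub in \<open>auto simp: Let_def intro: has_vector_derivative_within_subset\<close>)
  then show ?thesis
    using sol sub unfolding string_solution_def locally_abs_continuous_on_def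
    by (meson order_trans subsetD)
qed

text \<open>Right-hand side, state set and boundary signals matter only through their effect along
  the given \<open>x\<close>. The projected system, the shrinking of the state set and the change of
  boundary signals are all handled by this rule.\<close>

lemma string_solution_cong:
  assumes sol: "string_solution f D n u w J x"
    and states: "\<And>t. t \<in> J \<Longrightarrow> x t \<in> states D' n"
    and eq: "\<And>t i. t \<in> J \<Longrightarrow> i \<in> {1..n} \<Longrightarrow>
      let X = with_boundary n (u t) (w t) (x t); X' = with_boundary n (u' t) (w' t) (x t)
      in f (X (i - 1)) (X i) (X (i + 1)) = f' (X' (i - 1)) (X' i) (X' (i + 1))"
  shows "string_solution f' D' n u' w' J x"
proof -
  have "AE t\<in>J in lebesgue. \<forall>i\<in>{1..n}. let X = with_boundary n (u t) (w t) (x t)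
      in ((\<lambda>s. x s i) has_vector_derivative f (X (i - 1)) (X i) (X (i + 1))) (at t within J)"
    using sol by (simp add: string_solution_def)
  then have "AE t\<in>J in lebesgue. \<forall>i\<in>{1..n}. let X = with_boundary n (u' t) (w' t) (x t)
      in ((\<lambda>s. x s i) has_vector_derivative f' (X (i - 1)) (X i) (X (i + 1))) (at t within J)"
    by eventually_elim (use eq in \<open>simp add: Let_def\<close>)
  then show ?thesis
    using sol states unfolding string_solution_def by blast
qed

lemma string_solution_abs_continuous_on:
  assumes "string_solution f D n u w {0..T} x" "i \<in> {1..n}"
  shows "abs_continuous_on {0..T} (\<lambda>t. x t i)"
  using assms unfolding string_solution_def locally_abs_continuous_on_def by blast

text \<open>Gronwall's argument in differential form: the squared distance of two solutions,
  multiplied by \<open>exp (- c * t)\<close>, starts at zero and has nonpositive derivative almost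
  everywhere. The boundary entries cancel since both solutions share \<open>u\<close> and
  \<open>w\<close>.\<close>

lemma string_solution_unique_lipschitz:
  fixes f :: "'a::euclidean_space \<Rightarrow> 'a \<Rightarrow> 'a \<Rightarrow> 'a"
  assumes lip: "M-lipschitz_on (C \<times> C \<times> C) (\<lambda>(a, b, c). f a b c)"
    and u: "\<And>t. t \<in> {0..T} \<Longrightarrow> u t \<in> C" and w: "\<And>t. t \<in> {0..T} \<Longrightarrow> w t \<in> C"
    and x: "string_solution f C n u w {0..T} x" and y: "string_solution f C n u w {0..T} y"
    and init: "x 0 = y 0" and "T \<ge> 0"
  shows "x T = y T"
proof -
  define \<Delta> where "\<Delta> i t = x t i - y t i" for i t
  define E where "E t = (\<Sum>i=1..n. \<Delta> i t \<bullet> \<Delta> i t)" for t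
  \<comment> \<open>The factor 6 is 2 from differentiating a square times 3 from the three arguments
    of \<open>f\<close>; there are \<open>n\<close> such terms.\<close>
  define c where "c = 6 * M * n"
  have M0: "M \<ge> 0" by (rule lipschitz_on_nonneg[OF lip])
  have E_ac: "abs_continuous_on {0..T} E"
    unfolding E_def \<Delta>_def
    by (intro abs_continuous_on_sum abs_continuous_on_Icc_inner abs_continuous_on_diff
        string_solution_abs_continuous_on[OF x] string_solution_abs_continuous_on[OF y])
  obtain K where "K-lipschitz_on {0..T} (\<lambda>t. exp (- c * t))"
    by (rule C1_imp_lipschitz_on_Icc[of 0 T "\<lambda>t. exp (- c * t)" "\<lambda>t. - c * exp (- c * t)"])
      (auto intro!: derivative_eq_intros continuous_intros)
  then have ac: "abs_continuous_on {0..T} (\<lambda>t. exp (- c * t) * E t)"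
    using abs_continuous_on_Icc_inner[OF lipschitz_on_imp_abs_continuous_on E_ac] by simp
  have Ex: "AE t in lebesgue. t \<in> {0..T} \<longrightarrow> (\<forall>i\<in>{1..n}. let X = with_boundary n (u t) (w t) (x t)
      in ((\<lambda>s. x s i) has_vector_derivative f (X (i - 1)) (X i) (X (i + 1))) (at t within {0..T}))"
    using x by (simp add: string_solution_def)
  have Ey: "AE t in lebesgue. t \<in> {0..T} \<longrightarrow> (\<forall>i\<in>{1..n}. let X = with_boundary n (u t) (w t) (y t)
      in ((\<lambda>s. y s i) has_vector_derivative f (X (i - 1)) (X i) (X (i + 1))) (at t within {0..T}))"
    using y by (simp add: string_solution_def)
  have "AE t\<in>{0..T} in lebesgue.
      \<exists>d\<le>0. ((\<lambda>t. exp (- c * t) * E t) has_real_derivative d) (at t within {0..T})"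
    using Ex Ey
  proof eventually_elim
    case (elim t)
    show ?case
    proof
      assume t: "t \<in> {0..T}"
      define X where "X = with_boundary n (u t) (w t) (x t)"
      define Y where "Y = with_boundary n (u t) (w t) (y t)"
      define d where "d i = f (X (i - 1)) (X i) (X (i + 1)) - f (Y (i - 1)) (Y i) (Y (i + 1))" for i
      have \<Delta>': "(\<Delta> i has_vector_derivative d i) (at t within {0..T})" if "i \<in> {1..n}" for i
        using elim t that unfolding \<Delta>_def d_def X_def Y_def Let_def
        by (auto intro!: has_vector_derivative_diff)
      have E': "(E has_real_derivative (\<Sum>i=1..n. 2 * (\<Delta> i t \<bullet> d i))) (at t within {0..T})"
        unfolding E_def has_real_derivative_iff_has_vector_derivative
      proof (rule has_vector_derivative_sum)
        fix i assume "i \<in> {1..n}"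
        from bounded_bilinear.has_vector_derivative[OF bounded_bilinear_inner \<Delta>'[OF this] \<Delta>'[OF this]]
        show "((\<lambda>t. \<Delta> i t \<bullet> \<Delta> i t) has_vector_derivative 2 * (\<Delta> i t \<bullet> d i)) (at t within {0..T})"
          by (simp add: inner_commute)
      qed
      have \<Delta>_le: "norm (\<Delta> i t) \<le> sqrt (E t)" if "i \<in> {1..n}" for i
      proof -
        have "\<Delta> i t \<bullet> \<Delta> i t \<le> E t"
          unfolding E_def by (rule member_le_sum[OF that]) auto
        then show ?thesis by (simp add: norm_eq_sqrt_inner)
      qed
      have E0: "E t \<ge> 0" unfolding E_def by (intro sum_nonneg) auto
      have XY_dist: "dist (X k) (Y k) \<le> sqrt (E t)" if "k \<le> Suc n" for k
        using \<Delta>_le[of k] that E0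
        by (auto simp: X_def Y_def with_boundary_def \<Delta>_def dist_norm)
      have x_C: "x t k \<in> C" and y_C: "y t k \<in> C" if "k \<in> {1..n}" for k
        using x y t that by (auto simp: string_solution_def states_def PiE_iff)
      have XY_in: "X k \<in> C \<and> Y k \<in> C" if "k \<le> Suc n" for k
        using x_C[of k] y_C[of k] that u[OF t] w[OF t]
        by (auto simp: X_def Y_def with_boundary_def)
      have d_le: "norm (d i) \<le> M * (3 * sqrt (E t))" if "i \<in> {1..n}" for i
      proof -
        have "norm (d i) \<le> M * dist (X (i - 1), X i, X (i + 1)) (Y (i - 1), Y i, Y (i + 1))"
          using lipschitz_onD[OF lip, of "(X (i - 1), X i, X (i + 1))" "(Y (i - 1), Y i, Y (i + 1))"]
            XY_in that by (auto simp: d_def dist_norm)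
        also have "\<dots> \<le> M * (sqrt (E t) + (sqrt (E t) + sqrt (E t)))"
          using that M0 by (intro mult_left_mono order_trans[OF dist_triple_le] add_mono XY_dist) auto
        finally show ?thesis by simp
      qed
      have "(\<Sum>i=1..n. 2 * (\<Delta> i t \<bullet> d i)) \<le> (\<Sum>i=1..n. 6 * M * E t)"
      proof (rule sum_mono)
        fix i assume i: "i \<in> {1..n}"
        have "\<Delta> i t \<bullet> d i \<le> norm (\<Delta> i t) * norm (d i)" by (rule norm_cauchy_schwarz)
        also have "\<dots> \<le> sqrt (E t) * (M * (3 * sqrt (E t)))"
          using \<Delta>_le[OF i] d_le[OF i] E0 by (intro mult_mono) auto
        also have "\<dots> = 3 * M * E t" using E0 by (simp add: algebra_simps)
        finally show "2 * (\<Delta> i t \<bullet> d i) \<le> 6 * M * E t" by simp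
      qed
      then have le: "(\<Sum>i=1..n. 2 * (\<Delta> i t \<bullet> d i)) \<le> c * E t" by (simp add: c_def mult_ac)
      let ?d = "exp (- c * t) * ((\<Sum>i=1..n. 2 * (\<Delta> i t \<bullet> d i)) - c * E t)"
      have "((\<lambda>t. exp (- c * t) * E t) has_real_derivative ?d) (at t within {0..T})"
        by (rule derivative_eq_intros E' refl)+ (simp add: algebra_simps)
      moreover have "?d \<le> 0" using le by (intro mult_nonneg_nonpos) auto
      ultimately show "\<exists>d\<le>0. ((\<lambda>t. exp (- c * t) * E t) has_real_derivative d) (at t within {0..T})"
        by blast
    qed
  qed
  from abs_continuous_on_AE_deriv_nonpos[OF ac \<open>T \<ge> 0\<close> this]
  have "E T \<le> 0" using init by (simp add: E_def \<Delta>_def mult_le_0_iff)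
  then have "E T = 0" unfolding E_def by (intro antisym sum_nonneg) auto
  then have "\<forall>i\<in>{1..n}. x T i = y T i"
    unfolding E_def by (subst (asm) sum_nonneg_eq_0_iff) (auto simp: \<Delta>_def)
  moreover have "x T \<in> states C n" "y T \<in> states C n"
    using x y \<open>T \<ge> 0\<close> by (auto simp: string_solution_def)
  ultimately show ?thesis unfolding states_def by (metis PiE_ext)
qed

text \<open>The a priori bound \<open>invariant\<close> is demanded only of true solutions with
  values in \<open>C\<close>. At the first time at which the projected solution is outside the
  interior it is still in \<open>C\<close> by closedness, so it has been a true solution up to and
  including that time, and \<open>invariant\<close> gives a contradiction.\<close>

lemma string_solution_exists_invariant:
  fixes f :: "'a::euclidean_space \<Rightarrow> 'a \<Rightarrow> 'a \<Rightarrow> 'a"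
  assumes C: "compact C" "convex C"
    and lip: "M-lipschitz_on (C \<times> C \<times> C) (\<lambda>(a, b, c). f a b c)"
    and u: "u \<in> borel_measurable (lebesgue_on {0..})" "\<And>t. t \<ge> 0 \<Longrightarrow> u t \<in> C"
    and w: "w \<in> borel_measurable (lebesgue_on {0..})" "\<And>t. t \<ge> 0 \<Longrightarrow> w t \<in> C"
    and \<xi>: "\<xi> \<in> states C n" and "T \<ge> 0"
    and invariant: "\<And>t x i. \<lbrakk>t \<in> {0..T}; string_solution f C n u w {0..t} x; x 0 = \<xi>; i \<in> {1..n}\<rbrakk>
      \<Longrightarrow> x t i \<in> interior C"
  shows "\<exists>x. string_solution f C n u w {0..T} x \<and> x 0 = \<xi>"
proof -
  have closed: "closed C" and ne: "C \<noteq> {}"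
    using C compact_imp_closed u(2)[of 0] by auto
  \<comment> \<open>Convexity makes the closest-point projection nonexpansive, so composing
    \<open>f\<close> with it in each argument gives a globally Lipschitz and bounded map.\<close>
  define p where "p = closest_point C"
  have p_in: "p a \<in> C" for a
    unfolding p_def by (rule closest_point_in_set[OF closed ne])
  have p_id: "p a = a" if "a \<in> C" for a
    unfolding p_def by (rule closest_point_self[OF that])
  have p_lip: "dist (p a) (p b) \<le> dist a b" for a b
    unfolding p_def by (rule closest_point_lipschitz[OF C(2) closed ne])
  define g where "g a b c = f (p a) (p b) (p c)" for a b c
  have "(3 * M)-lipschitz_on UNIV (\<lambda>(a, b, c). g a b c)"
  proof (rule lipschitz_onI)
    show "0 \<le> 3 * M" using lipschitz_on_nonneg[OF lip] by simp
    fix r s :: "'a \<times> 'a \<times> 'a"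
    obtain a b c a' b' c' where rs: "r = (a, b, c)" "s = (a', b', c')" by (metis prod_cases3)
    have fst_le: "dist a a' \<le> dist r s" and "dist (b, c) (b', c') \<le> dist r s"
      using dist_fst_le[of r s] dist_snd_le[of r s] by (auto simp: rs)
    then have snd_le: "dist b b' \<le> dist r s" "dist c c' \<le> dist r s"
      using dist_fst_le[of "(b, c)" "(b', c')"] dist_snd_le[of "(b, c)" "(b', c')"] by auto
    have "dist (g a b c) (g a' b' c') \<le> M * dist (p a, p b, p c) (p a', p b', p c')"
      using lipschitz_onD[OF lip, of "(p a, p b, p c)" "(p a', p b', p c')"] p_in by (simp add: g_def)
    also have "\<dots> \<le> M * (dist r s + (dist r s + dist r s))"
      using fst_le snd_le
      by (intro mult_left_mono order_trans[OF dist_triple_le] add_mono order_trans[OF p_lip]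
          lipschitz_on_nonneg[OF lip])
    finally show "dist (case r of (a, b, c) \<Rightarrow> g a b c) (case s of (a, b, c) \<Rightarrow> g a b c) \<le> 3 * M * dist r s"
      by (simp add: rs)
  qed
  moreover have "bounded ((\<lambda>(a, b, c). f a b c) ` (C \<times> C \<times> C))"
    by (intro compact_imp_bounded compact_continuous_image lipschitz_on_continuous_on[OF lip] compact_Times C)
  then obtain B where "\<And>r. r \<in> C \<times> C \<times> C \<Longrightarrow> norm (case r of (a, b, c) \<Rightarrow> f a b c) \<le> B"
    by (auto simp: bounded_iff)
  then have "norm (g a b c) \<le> B" for a b c
    using p_in by (auto simp: g_def)
  moreover have "\<xi> \<in> states UNIV n" using \<xi> by (auto simp: states_def PiE_iff)
  ultimately obtain x where x: "string_solution g UNIV n u w {0..} x" and x0: "x 0 = \<xi>"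
    using string_solution_exists_lipschitz u(1) w(1) by blast
  have x_ext: "x t \<in> extensional {1..n}" if "t \<ge> 0" for t
    using x that by (auto simp: string_solution_def states_def PiE_def)
  have x_sol: "string_solution f C n u w {0..t} x"
    if "0 \<le> t" and in_C: "\<And>s i. s \<in> {0..t} \<Longrightarrow> i \<in> {1..n} \<Longrightarrow> x s i \<in> C" for t
  proof (rule string_solution_cong[OF string_solution_subset[OF x]])
    show "{0..t} \<subseteq> {0..}" by auto
    show "x s \<in> states C n" if "s \<in> {0..t}" for s
      using in_C[OF that] x_ext that by (auto simp: states_def PiE_def)
    fix s i assume s: "s \<in> {0..t}" and i: "i \<in> {1..n}"
    have in_C': "with_boundary n (u s) (w s) (x s) k \<in> C" if "k \<le> Suc n" for k
      using that in_C[OF s, of k] s u w by (auto simp: with_boundary_def)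
    show "let X = with_boundary n (u s) (w s) (x s); X' = with_boundary n (u s) (w s) (x s)
      in g (X (i - 1)) (X i) (X (i + 1)) = f (X' (i - 1)) (X' i) (X' (i + 1))"
      using i in_C'[of "i - 1"] in_C'[of i] in_C'[of "i + 1"] by (auto simp: g_def p_id Let_def)
  qed
  have x_cont: "continuous_on {0..T} (\<lambda>t. x t i)" if "i \<in> {1..n}" for i
    by (rule abs_continuous_on_imp_continuous_on
      [OF string_solution_abs_continuous_on[OF string_solution_subset[OF x]]]) (use that in auto)
  \<comment> \<open>\<open>Z\<close> collects the times at which some component is outside the
    interior. It is compact, so a first such time exists if there is any.\<close>
  define Z where "Z = (\<Union>i\<in>{1..n}. {t\<in>{0..T}. x t i \<in> - interior C})"
  have "closed Z"
    unfolding Z_def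
  proof (intro closed_UN finite_atLeastAtMost ballI)
    fix i assume "i \<in> {1..n}"
    from continuous_closed_preimage[OF x_cont[OF this] closed_atLeastAtMost closed_Compl[OF open_interior[of C]]]
    show "closed {t\<in>{0..T}. x t i \<in> - interior C}" by (simp add: vimage_def Int_def)
  qed
  have "Z = {}"
  proof (rule ccontr)
    assume "Z \<noteq> {}"
    have "{0..T} \<inter> Z = Z" by (auto simp: Z_def)
    then have "compact Z" using compact_Int_closed[OF compact_Icc \<open>closed Z\<close>] by metis
    from compact_attains_inf[OF this \<open>Z \<noteq> {}\<close>]
    obtain \<sigma> where \<sigma>: "\<sigma> \<in> Z" "\<And>t. t \<in> Z \<Longrightarrow> \<sigma> \<le> t" by blast
    have \<sigma>T: "\<sigma> \<in> {0..T}" using \<sigma>(1) by (auto simp: Z_def)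
    have before: "x s i \<in> C" if "0 \<le> s" "s < \<sigma>" "i \<in> {1..n}" for s i
    proof -
      have "s \<notin> Z" using \<sigma>(2)[of s] that by auto
      then show ?thesis using that \<sigma>T interior_subset[of C] by (auto simp: Z_def)
    qed
    \<comment> \<open>The value at \<open>\<sigma>\<close> is a limit of earlier values in the
      closed set \<open>C\<close>; at \<open>\<sigma> = 0\<close> there are no earlier times and the
      initial state is used.\<close>
    have at: "x \<sigma> i \<in> C" if i: "i \<in> {1..n}" for i
    proof (cases "\<sigma> = 0")
      case True
      then show ?thesis using x0 \<xi> i by (auto simp: states_def PiE_iff)
    next
      case False
      then have "\<sigma> \<in> closure {0..<\<sigma>}" using \<sigma>T by (simp add: closure_atLeastLessThan)
      moreover have "continuous_on (closure {0..<\<sigma>}) (\<lambda>t. x t i)"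
        using False \<sigma>T by (intro continuous_on_subset[OF x_cont[OF i]]) (auto simp: closure_atLeastLessThan)
      moreover have "(\<lambda>t. x t i) ` {0..<\<sigma>} \<subseteq> C" using before i by auto
      ultimately show ?thesis
        using image_closure_subset[of "{0..<\<sigma>}" "\<lambda>t. x t i" C] closed by blast
    qed
    have "string_solution f C n u w {0..\<sigma>} x"
    proof (rule x_sol)
      show "0 \<le> \<sigma>" using \<sigma>T by simp
      show "x s i \<in> C" if "s \<in> {0..\<sigma>}" "i \<in> {1..n}" for s i
        using that before at by (cases "s = \<sigma>") auto
    qed
    then have "x \<sigma> i \<in> interior C" if "i \<in> {1..n}" for i
      using invariant[of \<sigma> x i] \<sigma>T x0 that by blast
    then show False using \<sigma>(1) by (auto simp: Z_def)
  qed
  then have "string_solution f C n u w {0..T} x"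
    using interior_subset[of C] \<open>T \<ge> 0\<close> by (intro x_sol) (auto simp: Z_def)
  then show ?thesis using x0 by blast
qed

text \<open>\<open>invariant\<close> speaks of solutions in all of \<open>D\<close>, so it serves
  twice: it yields existence in \<open>C T\<close>, and it confines every competing solution to a
  set on which \<open>f\<close> is Lipschitz, which yields uniqueness in \<open>D\<close>.\<close>

lemma string_global_solution_exists_unique:
  fixes f :: "'a::euclidean_space \<Rightarrow> 'a \<Rightarrow> 'a \<Rightarrow> 'a" and C :: "real \<Rightarrow> 'a set"
  assumes C: "\<And>T. compact (C T)" "\<And>T. convex (C T)" "\<And>T. C T \<subseteq> D"
    and lip: "\<And>T. \<exists>M. M-lipschitz_on (C T \<times> C T \<times> C T) (\<lambda>(a, b, c). f a b c)"
    and u: "u \<in> borel_measurable (lebesgue_on {0..})" "\<And>T t. t \<ge> 0 \<Longrightarrow> u t \<in> C T"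
    and w: "w \<in> borel_measurable (lebesgue_on {0..})" "\<And>T t. t \<ge> 0 \<Longrightarrow> w t \<in> C T"
    and \<xi>: "\<And>T. \<xi> \<in> states (C T) n"
    and invariant: "\<And>T t x i. \<lbrakk>t \<in> {0..T}; string_solution f D n u w {0..t} x; x 0 = \<xi>; i \<in> {1..n}\<rbrakk>
      \<Longrightarrow> x t i \<in> interior (C T)"
  shows "\<exists>x. string_solution f D n u w {0..} x \<and> x 0 = \<xi> \<and>
    (\<forall>T>0. \<forall>x'. string_solution f D n u w {0..<T} x' \<and> x' 0 = \<xi> \<longrightarrow> (\<forall>t\<in>{0..<T}. x' t = x t))"
proof -
  have states_mono: "states (C T) n \<subseteq> states D n" for T
    unfolding states_def using C(3)[of T] by (intro PiE_mono) auto
  have D_sol: "string_solution f D n u w J x" if "string_solution f (C T) n u w J x" for T J x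
    by (rule string_solution_cong[OF that]) (use that states_mono in \<open>auto simp: string_solution_def Let_def\<close>)
  have C_sol: "string_solution f (C t) n u w {0..t} x"
    if x: "string_solution f D n u w {0..t} x" "x 0 = \<xi>" for t x
  proof (rule string_solution_cong[OF x(1)])
    fix s assume s: "s \<in> {0..t}"
    have "x s i \<in> C t" if "i \<in> {1..n}" for i
    proof -
      have "string_solution f D n u w {0..s} x"
        using s by (intro string_solution_subset[OF x(1)]) auto
      then have "x s i \<in> interior (C t)" using invariant[of s t x i] s x(2) that by blast
      then show ?thesis using interior_subset by blast
    qed
    moreover have "x s \<in> extensional {1..n}"
      using x(1) s by (auto simp: string_solution_def states_def PiE_def)
    ultimately show "x s \<in> states (C t) n" by (auto simp: states_def PiE_def)
  qed (simp add: Let_def)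
  have unique: "x t = y t"
    if "t \<ge> 0" "string_solution f D n u w {0..t} x" "x 0 = \<xi>"
      "string_solution f D n u w {0..t} y" "y 0 = \<xi>" for t x y
  proof -
    obtain M where "M-lipschitz_on (C t \<times> C t \<times> C t) (\<lambda>(a, b, c). f a b c)" using lip by blast
    from string_solution_unique_lipschitz[OF this, of t u w n x y] show ?thesis
      using that C_sol u(2) w(2) by auto
  qed
  have "\<exists>x. string_solution f D n u w {0..real (Suc k)} x \<and> x 0 = \<xi>" for k
  proof -
    obtain M where "M-lipschitz_on (C (Suc k) \<times> C (Suc k) \<times> C (Suc k)) (\<lambda>(a, b, c). f a b c)"
      using lip by blast
    then have "\<exists>x. string_solution f (C (Suc k)) n u w {0..real (Suc k)} x \<and> x 0 = \<xi>"
      using invariant D_sol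
      by (intro string_solution_exists_invariant[OF C(1,2) _ u w \<xi>]) auto
    then show ?thesis using D_sol by blast
  qed
  then obtain X where X: "\<And>k. string_solution f D n u w {0..real (Suc k)} (X k)"
    and X0: "\<And>k. X k 0 = \<xi>"
    by metis
  \<comment> \<open>The solutions on \<open>{0..k + 1}\<close> agree where they overlap, by
    uniqueness, so the index selected at time \<open>t\<close> does not matter.\<close>
  define x where "x t = X (nat \<lceil>t\<rceil>) t" for t
  have x_eq: "x t = X k t" if "t \<in> {0..real (Suc k)}" for t k
  proof -
    have "t \<le> real (Suc (nat \<lceil>t\<rceil>))" using that by (simp add: of_nat_nat) linarith
    then have "string_solution f D n u w {0..t} (X (nat \<lceil>t\<rceil>))" "string_solution f D n u w {0..t} (X k)"
      using that by (auto intro!: string_solution_subset[OF X])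
    then show ?thesis
      unfolding x_def using that X0 by (intro unique[of t "X (nat \<lceil>t\<rceil>)" "X k"]) auto
  qed
  have x_sol: "string_solution f D n u w {0..} x"
    unfolding string_solution_def
  proof (intro conjI ballI)
    fix t :: real assume t: "t \<in> {0..}"
    then have "t \<in> {0..real (Suc (nat \<lceil>t\<rceil>))}" by (simp add: of_nat_nat) linarith
    then show "x t \<in> states D n"
      using X[of "nat \<lceil>t\<rceil>"] unfolding string_solution_def x_def by blast
  next
    fix i assume i: "i \<in> {1..n}"
    show "locally_abs_continuous_on {0..} (\<lambda>t. x t i)"
      unfolding locally_abs_continuous_on_def
    proof (intro allI impI)
      fix a b :: real assume ab: "{a..b} \<subseteq> {0..}"
      obtain k where "b \<le> real k" using real_arch_simple by blast
      then have sub: "{a..b} \<subseteq> {0..real (Suc k)}" using ab by force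
      have "abs_continuous_on {a..b} (\<lambda>t. X k t i)"
        by (rule abs_continuous_on_subset[OF string_solution_abs_continuous_on[OF X i] sub])
      then show "abs_continuous_on {a..b} (\<lambda>t. x t i)"
        by (rule abs_continuous_on_cong) (simp only: x_eq[OF subsetD[OF sub]])
    qed
  next
    have "AE t in lebesgue. \<forall>k. t \<in> {0..real (Suc k)} \<longrightarrow> (\<forall>i\<in>{1..n}.
        let Y = with_boundary n (u t) (w t) (X k t) in ((\<lambda>s. X k s i) has_vector_derivative
          f (Y (i - 1)) (Y i) (Y (i + 1))) (at t within {0..real (Suc k)}))"
      using X by (simp only: AE_all_countable string_solution_def) blast
    then show "AE t\<in>{0..} in lebesgue. \<forall>i\<in>{1..n}.
        let Y = with_boundary n (u t) (w t) (x t) in ((\<lambda>s. x s i) has_vector_derivative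
          f (Y (i - 1)) (Y i) (Y (i + 1))) (at t within {0..})"
    proof eventually_elim
      case (elim t)
      show ?case
      proof (intro impI ballI)
        fix i assume t: "t \<in> {0..}" and i: "i \<in> {1..n}"
        \<comment> \<open>Strict inequality is essential: at the right endpoint the derivative
          within the bounded interval would be one-sided.\<close>
        obtain k where "t < real k" using reals_Archimedean2 by blast
        then have tk: "t < real (Suc k)" "t \<in> {0..real (Suc k)}" using t by auto
        define Y where "Y = with_boundary n (u t) (w t) (x t)"
        have "((\<lambda>s. X k s i) has_vector_derivative f (Y (i - 1)) (Y i) (Y (i + 1)))
            (at t within {0..real (Suc k)})"
          using elim tk(2) i x_eq[OF tk(2)] unfolding Y_def Let_def by metis
        then have "((\<lambda>s. x s i) has_vector_derivative f (Y (i - 1)) (Y i) (Y (i + 1)))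
            (at t within {0..real (Suc k)})"
          by (rule has_vector_derivative_transform[OF tk(2), rotated]) (use x_eq in auto)
        then show "let Y = with_boundary n (u t) (w t) (x t) in ((\<lambda>s. x s i) has_vector_derivative
            f (Y (i - 1)) (Y i) (Y (i + 1))) (at t within {0..})"
          unfolding at_within_Icc_eq_at_within_Ici[OF tk(1)] Y_def by simp
      qed
    qed
  qed
  have x0: "x 0 = \<xi>" using x_eq[of 0 0] X0 by simp
  have "x' t = x t"
    if "string_solution f D n u w {0..<T} x'" "x' 0 = \<xi>" "t \<in> {0..<T}" for T x' t
  proof (rule unique)
    show "string_solution f D n u w {0..t} x'"
      by (rule string_solution_subset[OF that(1)]) (use that in auto)
    show "string_solution f D n u w {0..t} x"
      by (rule string_solution_subset[OF x_sol]) auto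
  qed (use that x0 in auto)
  then show ?thesis using x_sol x0 by blast
qed

section \<open>The vehicle string\<close>

text \<open>Hides the constant, so that the regularity of a long expression follows by composing
  introduction rules.\<close>

definition is_lipschitz_on :: "'a::metric_space set \<Rightarrow> ('a \<Rightarrow> 'b::metric_space) \<Rightarrow> bool" where
  "is_lipschitz_on A g \<longleftrightarrow> (\<exists>M. M-lipschitz_on A g)"

lemma is_lipschitz_on_const: "is_lipschitz_on A (\<lambda>x. c)"
  unfolding is_lipschitz_on_def using lipschitz_on_constant by blast

lemma is_lipschitz_on_add:
  fixes g h :: "'a::metric_space \<Rightarrow> 'b::real_normed_vector"
  shows "is_lipschitz_on A g \<Longrightarrow> is_lipschitz_on A h \<Longrightarrow> is_lipschitz_on A (\<lambda>x. g x + h x)"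
  unfolding is_lipschitz_on_def using lipschitz_on_add by blast

lemma is_lipschitz_on_diff:
  fixes g h :: "'a::metric_space \<Rightarrow> 'b::real_normed_vector"
  shows "is_lipschitz_on A g \<Longrightarrow> is_lipschitz_on A h \<Longrightarrow> is_lipschitz_on A (\<lambda>x. g x - h x)"
  unfolding is_lipschitz_on_def using lipschitz_on_diff by blast

lemma is_lipschitz_on_Pair:
  "is_lipschitz_on A g \<Longrightarrow> is_lipschitz_on A h \<Longrightarrow> is_lipschitz_on A (\<lambda>x. (g x, h x))"
  unfolding is_lipschitz_on_def using lipschitz_on_Pair by blast

lemma is_lipschitz_on_fst: "is_lipschitz_on A g \<Longrightarrow> is_lipschitz_on A (\<lambda>x. fst (g x))"
  unfolding is_lipschitz_on_def lipschitz_on_def by (meson dist_fst_le order_trans)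

lemma is_lipschitz_on_snd: "is_lipschitz_on A g \<Longrightarrow> is_lipschitz_on A (\<lambda>x. snd (g x))"
  unfolding is_lipschitz_on_def lipschitz_on_def by (meson dist_snd_le order_trans)

lemma is_lipschitz_on_id: "is_lipschitz_on A (\<lambda>x. x)"
  unfolding is_lipschitz_on_def using lipschitz_on_id by blast

lemma is_lipschitz_on_mult:
  fixes g h :: "'a::metric_space \<Rightarrow> real"
  assumes "compact A" "is_lipschitz_on A g" "is_lipschitz_on A h"
  shows "is_lipschitz_on A (\<lambda>x. g x * h x)"
proof -
  obtain M N where M: "M-lipschitz_on A g" and N: "N-lipschitz_on A h"
    using assms unfolding is_lipschitz_on_def by blast
  have "bounded (k ` A)" if "K-lipschitz_on A k" for k :: "'a \<Rightarrow> real" and K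
    using that \<open>compact A\<close>
    by (intro compact_imp_bounded compact_continuous_image lipschitz_on_continuous_on)
  then obtain G H where G: "\<forall>x\<in>A. \<bar>g x\<bar> \<le> G" and H: "\<forall>x\<in>A. \<bar>h x\<bar> \<le> H"
    using M N unfolding bounded_iff by (metis image_eqI real_norm_def)
  have nonneg: "0 \<le> M" "0 \<le> N" using M N lipschitz_on_nonneg by auto
  have "(M * max H 0 + max G 0 * N)-lipschitz_on A (\<lambda>x. g x * h x)"
  proof (rule lipschitz_onI)
    fix x y assume xy: "x \<in> A" "y \<in> A"
    have "\<bar>g x * h x - g y * h y\<bar> = \<bar>(g x - g y) * h x + g y * (h x - h y)\<bar>"
      by (simp add: algebra_simps)
    also have "\<dots> \<le> \<bar>g x - g y\<bar> * \<bar>h x\<bar> + \<bar>g y\<bar> * \<bar>h x - h y\<bar>"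
      by (metis abs_mult abs_triangle_ineq)
    also have "\<dots> \<le> (M * dist x y) * max H 0 + max G 0 * (N * dist x y)"
      using lipschitz_onD[OF M xy] lipschitz_onD[OF N xy] G H xy nonneg
      by (intro add_mono mult_mono) (auto simp: dist_real_def le_max_iff_disj)
    finally show "dist (g x * h x) (g y * h y) \<le> (M * max H 0 + max G 0 * N) * dist x y"
      by (simp add: dist_real_def algebra_simps)
  qed (use nonneg in auto)
  then show ?thesis unfolding is_lipschitz_on_def by blast
qed

text \<open>Connectedness makes the image of \<open>g\<close> a compact interval inside
  \<open>U\<close>, and on that interval the mean value theorem turns the bound on
  \<open>\<phi>'\<close> into a Lipschitz constant.\<close>

lemma is_lipschitz_on_C1_compose:
  fixes \<phi> :: "real \<Rightarrow> real"
  assumes A: "compact A" "connected A" and g: "is_lipschitz_on A g" "g ` A \<subseteq> U"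
    and der: "\<And>x. x \<in> U \<Longrightarrow> (\<phi> has_real_derivative \<phi>' x) (at x)" and cont: "continuous_on U \<phi>'"
  shows "is_lipschitz_on A (\<lambda>x. \<phi> (g x))"
proof -
  obtain M where M: "M-lipschitz_on A g" using g unfolding is_lipschitz_on_def by blast
  have "connected (g ` A)" "compact (g ` A)"
    using A lipschitz_on_continuous_on[OF M] connected_continuous_image compact_continuous_image by blast+
  then obtain a b where ab: "g ` A = {a..b}"
    using connected_compact_interval_1[of "g ` A"] by auto
  then have sub: "{a..b} \<subseteq> U" using g(2) by simp
  obtain K where "K-lipschitz_on {a..b} \<phi>"
    by (rule C1_imp_lipschitz_on_Icc[OF der[OF subsetD[OF sub]] continuous_on_subset[OF cont sub]])
  then have "K-lipschitz_on (g ` A) \<phi>" unfolding ab .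
  from lipschitz_on_compose2[OF M this] have "(K * M)-lipschitz_on A (\<lambda>x. \<phi> (g x))" .
  then show ?thesis unfolding is_lipschitz_on_def by blast
qed

lemma Ck_on_differentiable:
  "Ck_on k g A \<Longrightarrow> j < k \<Longrightarrow> x \<in> A \<Longrightarrow> (deriv ^^ j) g differentiable (at x)"
  unfolding Ck_on_def by blast

text \<open>Links the Lebesgue integral in the norm to the gauge integral in which the energy
  argument is carried out.\<close>

lemma L2_norm_upto_eq_integral:
  assumes "(\<lambda>s. (norm (y s))\<^sup>2) integrable_on {0..t}"
  shows "L2_norm_upto t y = sqrt (integral {0..t} (\<lambda>s. (norm (y s))\<^sup>2))"
proof -
  have "(\<lambda>s. (norm (y s))\<^sup>2) absolutely_integrable_on {0..t}"
    by (rule nonnegative_absolutely_integrable_1[OF assms]) simp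
  then show ?thesis
    unfolding L2_norm_upto_def by (simp add: set_lebesgue_integral_eq_integral(2))
qed

locale vehicle_string =
  fixes L lam vmax vstar mu :: real and Phi b :: "real \<Rightarrow> real"
  assumes L_less: "L < lam" and vmax: "vmax > 0"
    and vstar: "vstar \<in> {0<..<vmax}" and mu: "mu > 0"
    and Phi_C3: "Ck_on 3 Phi {L<..}" and Phi_nonneg: "\<And>x. x > L \<Longrightarrow> Phi x \<ge> 0"
    and Phi_lim: "filterlim Phi at_top (at_right L)"
    and Phi_zero: "\<And>x. x \<ge> lam \<Longrightarrow> Phi x = 0"
    and dPhi_neg: "\<And>x. x \<in> {L<..<lam} \<Longrightarrow> deriv Phi x < 0"
    and b_C2: "Ck_on 2 b UNIV" and b_mono: "strict_mono b"
    and b_range: "\<And>x. b x \<in> {vstar - vmax<..<vstar}" and b_0: "b 0 = 0"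
    and b_sign: "\<And>x. x \<noteq> 0 \<Longrightarrow> x * b x > 0" and db_pos: "\<And>x. deriv b x > 0"
begin

abbreviation "P \<equiv> P_fun vmax vstar b"
abbreviation "kappa \<equiv> kappa_fun vmax vstar b"
abbreviation "rhs \<equiv> vehicle_rhs lam vmax vstar mu Phi b"
abbreviation "V \<equiv> vehicle_V lam vmax Phi"
abbreviation "D \<equiv> {L - lam<..} \<times> (UNIV :: real set)"

section \<open>Regularity of \<open>Phi\<close> and \<open>b\<close>\<close>

lemma Phi_deriv: "x > L \<Longrightarrow> (Phi has_real_derivative deriv Phi x) (at x)"
  using Ck_on_differentiable[OF Phi_C3, of 0 x] by (simp add: DERIV_deriv_iff_real_differentiable)

lemma dPhi_deriv: "x > L \<Longrightarrow> (deriv Phi has_real_derivative deriv (deriv Phi) x) (at x)"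
  using Ck_on_differentiable[OF Phi_C3, of 1 x] by (simp add: DERIV_deriv_iff_real_differentiable)

lemma ddPhi_cont: "continuous_on {L<..} (deriv (deriv Phi))"
proof -
  have "deriv (deriv Phi) differentiable (at x)" if "x > L" for x
    using Ck_on_differentiable[OF Phi_C3, of 2 x] that by (simp add: numeral_2_eq_2)
  then show ?thesis
    by (intro differentiable_imp_continuous_on differentiable_at_imp_differentiable_on) auto
qed

lemma dPhi_cont: "continuous_on {L<..} (deriv Phi)"
  by (rule DERIV_continuous_on[OF has_field_derivative_at_within[OF dPhi_deriv]]) auto

lemma b_deriv: "(b has_real_derivative deriv b x) (at x)"
  using Ck_on_differentiable[OF b_C2, of 0 x] by (simp add: DERIV_deriv_iff_real_differentiable)

lemma db_cont: "continuous_on UNIV (deriv b)"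
proof -
  have "deriv b differentiable (at x)" for x
    using Ck_on_differentiable[OF b_C2, of 1 x] by simp
  then show ?thesis
    by (intro differentiable_imp_continuous_on differentiable_at_imp_differentiable_on) auto
qed

text \<open>The delicate point is \<open>x = lam\<close>, where \<open>Phi\<close> is known to be
  flat only to the right. The two-sided derivative exists, so it equals the right-hand one.\<close>

lemma dPhi_zero: "deriv Phi x = 0" if "x \<ge> lam" for x
proof -
  have "(Phi has_real_derivative deriv Phi x) (at x within {x..})"
    by (rule has_field_derivative_at_within[OF Phi_deriv]) (use that L_less in simp)
  moreover have "(Phi has_real_derivative 0) (at x within {x..})"
    by (rule has_field_derivative_transform_within[OF DERIV_const[of 0] zero_less_one])
      (use that Phi_zero in auto)
  moreover have "at x within {x..} \<noteq> bot"
    using trivial_limit_at_right_real[of x] by (simp add: at_within_Ici_at_right)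
  ultimately show ?thesis
    by (rule has_field_derivative_unique)
qed

lemma dPhi_nonpos: "deriv Phi x \<le> 0" if "x > L" for x
  using that dPhi_zero[of x] dPhi_neg[of x] by (cases "x < lam") auto

section \<open>The speed law \<open>P\<close> and \<open>kappa\<close>\<close>

text \<open>\<open>P y x\<close> is the positive root of \<open>P\<^sup>2 = v * (vmax - v)\<close>, where \<open>v = vstar + kappa y x\<close> is the
  speed of the vehicle.\<close>

lemma P_root:
  shows "P y x > 0" "(P y x)\<^sup>2 = (vstar + kappa y x) * (vmax - vstar - kappa y x)"
proof -
  define a where "a = vmax - vstar + b x"
  define c where "c = vstar - b x"
  have ac: "a > 0" "c > 0" "a + c = vmax" using b_range[of x] by (auto simp: a_def c_def)
  define R where "R = y\<^sup>2 * vmax\<^sup>2 + 4 * a * c"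
  \<comment> \<open>Since \<open>a + c = vmax\<close>, the radicand is the discriminant of
    \<open>(1 + y\<^sup>2) * p\<^sup>2 - y * (a - c) * p - a * c = 0\<close>, whose positive root is
    \<open>P y x\<close>.\<close>
  have R_eq: "R = (y * (a - c))\<^sup>2 + 4 * a * c * (1 + y\<^sup>2)"
    unfolding R_def ac(3)[symmetric] by (simp add: algebra_simps power2_eq_square)
  have y1: "1 + y\<^sup>2 > 0" by (simp add: add_pos_nonneg)
  have "4 * a * c * (1 + y\<^sup>2) > 0" using ac y1 by simp
  then have R_gt: "(y * (a - c))\<^sup>2 < R" and R0: "R \<ge> 0" by (auto simp: R_eq intro: add_nonneg_nonneg)
  have P_eq: "P y x = (y * (a - c) + sqrt R) / (2 * (1 + y\<^sup>2))"
    by (simp add: P_fun_def a_def c_def R_def algebra_simps)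
  have "\<bar>y * (a - c)\<bar> < sqrt R" using R_gt by (metis real_sqrt_abs real_sqrt_less_iff)
  then show "P y x > 0" unfolding P_eq using y1 by (intro divide_pos_pos) auto
  have "2 * (1 + y\<^sup>2) * P y x - y * (a - c) = sqrt R" unfolding P_eq using y1 by simp
  then have "(2 * (1 + y\<^sup>2) * P y x - y * (a - c))\<^sup>2 = R" using R0 by simp
  then have "4 * (1 + y\<^sup>2) * ((1 + y\<^sup>2) * (P y x)\<^sup>2 - P y x * y * (a - c) - a * c) = 0"
    unfolding R_eq by (simp add: algebra_simps power2_eq_square)
  then have "(1 + y\<^sup>2) * (P y x)\<^sup>2 - P y x * y * (a - c) - a * c = 0" using y1 by simp
  then show "(P y x)\<^sup>2 = (vstar + kappa y x) * (vmax - vstar - kappa y x)"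
    by (simp add: kappa_fun_def a_def c_def algebra_simps power2_eq_square)
qed

text \<open>The two factors in \<open>P_root\<close> have positive product and positive sum
  \<open>vmax\<close>, so both are positive: the speed stays strictly between 0 and
  \<open>vmax\<close>.\<close>

lemma kappa_bounds: "- vstar < kappa y x" "kappa y x < vmax - vstar"
proof -
  have "(vstar + kappa y x) * (vmax - vstar - kappa y x) > 0"
    using P_root[of y x] by (metis zero_less_power)
  then show "- vstar < kappa y x" "kappa y x < vmax - vstar"
    using vmax by (auto simp: zero_less_mult_iff)
qed

text \<open>Two numbers with sum \<open>vmax\<close> have product at most
  \<open>vmax\<^sup>2 / 4\<close>; apply this to \<open>P_root\<close>.\<close>

lemma P_le: "P y x \<le> vmax / 2"
proof (rule power2_le_imp_le)
  have "0 \<le> (vmax - 2 * (vstar + kappa y x))\<^sup>2" by simp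
  then show "(P y x)\<^sup>2 \<le> (vmax / 2)\<^sup>2"
    unfolding P_root(2) by (simp add: power2_eq_square algebra_simps)
  show "0 \<le> vmax / 2" using vmax by simp
qed

text \<open>\<open>m\<close> is the minimum of the positive continuous function
  \<open>deriv b\<close> on the interval, and the mean value theorem is applied from
  \<open>b 0 = 0\<close>. Since \<open>b\<close> is bounded, such a linear bound cannot hold for all
  \<open>q \<le> 0\<close>; this is what forces the restriction on the leader's output.\<close>

lemma sector_bound: "\<exists>m>0. \<forall>q\<in>{-1..0}. b q \<le> m * q"
proof -
  have "continuous_on {-1..0} (deriv b)" using db_cont continuous_on_subset by blast
  then obtain \<xi> where \<xi>: "\<And>q. q \<in> {-1..0} \<Longrightarrow> deriv b \<xi> \<le> deriv b q"
    using continuous_attains_inf[of "{-1..0}" "deriv b"] by (metis atLeastAtMost_iff compact_Icc empty_iff neg_le_0_iff_le order_refl zero_le_one)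
  have "b q \<le> deriv b \<xi> * q" if q: "q \<in> {-1..0}" for q
  proof (cases "q = 0")
    case False
    with q have "q < 0" by auto
    then obtain \<zeta> where \<zeta>: "q < \<zeta>" "\<zeta> < 0" "b 0 - b q = (0 - q) * deriv b \<zeta>"
      using MVT2[of q 0 b "deriv b"] b_deriv by blast
    have "(- q) * deriv b \<xi> \<le> (- q) * deriv b \<zeta>"
      using \<xi>[of \<zeta>] \<zeta> q by (intro mult_left_mono) auto
    then show ?thesis using \<zeta>(3) by (simp add: b_0 mult.commute)
  qed (simp add: b_0)
  then show ?thesis using db_pos by blast
qed

text \<open>If \<open>kappa u q < 0\<close> then \<open>- b q < \<bar>u\<bar> * vmax / 2\<close>, which by the choice of \<open>\<Lambda>\<close> places \<open>q\<close> in
  \<open>[-1, 0]\<close>, where \<open>b\<close> has a linear bound.\<close>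

lemma inflow_bound:
  "\<exists>\<Lambda>>0. \<exists>c>0. \<forall>q\<le>0. \<forall>u. \<bar>u\<bar> \<le> \<Lambda> \<longrightarrow> q * kappa u q \<le> c * u\<^sup>2"
proof -
  obtain m where m: "m > 0" "\<And>q. q \<in> {-1..0} \<Longrightarrow> b q \<le> m * q"
    using sector_bound by blast
  \<comment> \<open>Solves \<open>\<Lambda> * vmax / 2 = - b (-1)\<close>, so that a drag below
    \<open>\<bar>u\<bar> * vmax / 2\<close> forces \<open>b (-1) < b q\<close>.\<close>
  define \<Lambda> where "\<Lambda> = - 2 * b (-1) / vmax"
  have "b (-1) < 0" using b_sign[of "-1"] by simp
  then have \<Lambda>0: "\<Lambda> > 0" using vmax by (simp add: \<Lambda>_def divide_neg_pos)
  \<comment> \<open>The constant is the product of the bound \<open>\<bar>u\<bar> * vmax / 2\<close>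
    on \<open>- (u * P u q)\<close> and the resulting bound
    \<open>\<bar>u\<bar> * vmax / (2 * m)\<close> on \<open>- q\<close>.\<close>
  have "q * kappa u q \<le> vmax\<^sup>2 / (4 * m) * u\<^sup>2" if q: "q \<le> 0" and u: "\<bar>u\<bar> \<le> \<Lambda>" for q u
  proof (cases "kappa u q \<ge> 0")
    case True
    then have "q * kappa u q \<le> 0" using q by (simp add: mult_nonpos_nonneg)
    also have "\<dots> \<le> vmax\<^sup>2 / (4 * m) * u\<^sup>2" using m by simp
    finally show ?thesis .
  next
    case False
    then have neg: "u * P u q < b q" by (simp add: kappa_fun_def)
    have uP: "- (u * P u q) \<le> \<bar>u\<bar> * (vmax / 2)"
    proof -
      have "- (u * P u q) \<le> \<bar>u\<bar> * P u q"
        using P_root(1)[of u q] by (metis abs_ge_minus_self abs_mult abs_of_pos)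
      also have "\<dots> \<le> \<bar>u\<bar> * (vmax / 2)" using P_le by (intro mult_left_mono) auto
      finally show ?thesis .
    qed
    have "\<bar>u\<bar> * (vmax / 2) \<le> \<Lambda> * (vmax / 2)" using u vmax by (intro mult_right_mono) auto
    also have "\<dots> = - b (-1)" using vmax by (simp add: \<Lambda>_def)
    finally have "b (-1) < b q" using uP neg by linarith
    then have "- 1 < q" using b_mono by (simp add: strict_mono_less)
    then have bq: "b q \<le> m * q" using m q by auto
    have mq: "m * (- q) \<le> \<bar>u\<bar> * (vmax / 2)" using bq uP neg by simp
    have bq0: "b q \<le> 0" using bq mult_nonneg_nonpos[of m q] m q by linarith
    have "q * kappa u q = (- q) * (- (u * P u q) + b q)"
      by (simp add: kappa_fun_def algebra_simps)
    also have "\<dots> \<le> (- q) * (\<bar>u\<bar> * (vmax / 2))"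
      using q uP bq0 by (intro mult_left_mono) auto
    also have "\<dots> = (m * (- q)) * (\<bar>u\<bar> * (vmax / 2)) / m" using m by simp
    also have "\<dots> \<le> (\<bar>u\<bar> * (vmax / 2)) * (\<bar>u\<bar> * (vmax / 2)) / m"
      using mq m vmax by (intro divide_right_mono mult_right_mono) auto
    also have "\<dots> = vmax\<^sup>2 / (4 * m) * u\<^sup>2"
      by (simp add: power2_eq_square field_simps flip: abs_mult)
    finally show ?thesis .
  qed
  moreover have "vmax\<^sup>2 / (4 * m) > 0" using vmax m by simp
  ultimately show ?thesis using \<Lambda>0 by blast
qed

section \<open>Energy rate of the whole string\<close>

lemma rhs_eq:
  "rhs a p c = (kappa (snd a) (deriv Phi (fst p + lam) - deriv Phi (fst a + lam))
        - kappa (snd p) (deriv Phi (fst c + lam) - deriv Phi (fst p + lam)),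
      - mu * snd p - (deriv Phi (fst c + lam) - deriv Phi (fst p + lam)) / vmax\<^sup>2
          * P (snd p) (deriv Phi (fst c + lam) - deriv Phi (fst p + lam)))"
  by (simp add: vehicle_rhs_def case_prod_beta)

text \<open>Summation by parts, with \<open>\<phi>\<close> the values of \<open>deriv Phi\<close>
  along the string and \<open>k\<close> the fluxes between neighbours.\<close>

lemma sum_flux_telescope:
  fixes \<phi> k :: "nat \<Rightarrow> real"
  shows "(\<Sum>i=1..n. \<phi> i * (k (i - 1) - k i))
    = (\<Sum>i=1..n. (\<phi> (i + 1) - \<phi> i) * k i) + \<phi> 1 * k 0 - \<phi> (Suc n) * k n"
  by (induction n) (auto simp: algebra_simps)

lemma energy_rate_le:
  fixes X :: "nat \<Rightarrow> real \<times> real"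
  assumes bound: "\<And>q. q \<le> 0 \<Longrightarrow> q * kappa (snd (X 0)) q \<le> c * (snd (X 0))\<^sup>2"
    and zero: "deriv Phi (fst (X 0) + lam) = 0" "deriv Phi (fst (X (Suc n)) + lam) = 0"
    and X1: "fst (X 1) + lam > L"
  shows "(\<Sum>i=1..n. vmax\<^sup>2 * snd (X i) * snd (rhs (X (i - 1)) (X i) (X (i + 1)))
      + deriv Phi (lam + fst (X i)) * fst (rhs (X (i - 1)) (X i) (X (i + 1))))
    \<le> c * (snd (X 0))\<^sup>2 - mu * vmax\<^sup>2 * (\<Sum>i=1..n. (snd (X i))\<^sup>2)"
proof -
  define \<phi> where "\<phi> i = deriv Phi (fst (X i) + lam)" for i
  define q where "q i = \<phi> (i + 1) - \<phi> i" for i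
  define y where "y i = snd (X i)" for i
  define k where "k i = kappa (y i) (q i)" for i
  have "vmax\<^sup>2 * snd (X i) * snd (rhs (X (i - 1)) (X i) (X (i + 1)))
      + deriv Phi (lam + fst (X i)) * fst (rhs (X (i - 1)) (X i) (X (i + 1)))
      = \<phi> i * (k (i - 1) - k i) - q i * k i - (q i * b (q i) + mu * vmax\<^sup>2 * (y i)\<^sup>2)"
    if "i \<in> {1..n}" for i
  proof -
    have rhs: "rhs (X (i - 1)) (X i) (X (i + 1))
        = (k (i - 1) - k i, - mu * y i - q i / vmax\<^sup>2 * P (y i) (q i))"
      using that by (simp add: rhs_eq k_def q_def y_def \<phi>_def)
    \<comment> \<open>The weight \<open>vmax\<^sup>2\<close> removes the denominator and
      \<open>y * P\<close> is rewritten as \<open>kappa + b\<close>: this splits the coupling into a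
      flux, which telescopes, and a dissipative term \<open>q * b q\<close>.\<close>
    have "vmax\<^sup>2 * y i * (- mu * y i - q i / vmax\<^sup>2 * P (y i) (q i))
        = - (mu * vmax\<^sup>2 * (y i)\<^sup>2) - q i * (k i + b (q i))"
      using vmax by (simp add: k_def kappa_fun_def field_simps power2_eq_square)
    then show ?thesis
      unfolding rhs by (simp add: y_def \<phi>_def add.commute algebra_simps)
  qed
  then have "(\<Sum>i=1..n. vmax\<^sup>2 * snd (X i) * snd (rhs (X (i - 1)) (X i) (X (i + 1)))
      + deriv Phi (lam + fst (X i)) * fst (rhs (X (i - 1)) (X i) (X (i + 1))))
      = (\<Sum>i=1..n. \<phi> i * (k (i - 1) - k i)) - (\<Sum>i=1..n. q i * k i)
        - (\<Sum>i=1..n. q i * b (q i) + mu * vmax\<^sup>2 * (y i)\<^sup>2)"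
    by (simp add: sum_subtractf)
  also have "\<dots> = \<phi> 1 * k 0 - \<phi> (Suc n) * k n - (\<Sum>i=1..n. q i * b (q i) + mu * vmax\<^sup>2 * (y i)\<^sup>2)"
    unfolding sum_flux_telescope by (simp add: q_def)
  \<comment> \<open>The tail term drops out because \<open>\<phi> (Suc n) = 0\<close>, and
    \<open>\<phi> 1 = q 0\<close> because \<open>\<phi> 0 = 0\<close>.\<close>
  also have "\<dots> = q 0 * k 0 - (\<Sum>i=1..n. q i * b (q i)) - mu * vmax\<^sup>2 * (\<Sum>i=1..n. (y i)\<^sup>2)"
    using zero by (simp add: \<phi>_def q_def sum.distrib sum_distrib_left)
  also have "\<dots> \<le> c * (y 0)\<^sup>2 - 0 - mu * vmax\<^sup>2 * (\<Sum>i=1..n. (y i)\<^sup>2)"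
  proof (intro diff_mono order_refl)
    have "q 0 \<le> 0" using zero(1) dPhi_nonpos[OF X1] by (simp add: q_def \<phi>_def)
    then show "q 0 * k 0 \<le> c * (y 0)\<^sup>2" using bound by (simp add: k_def y_def)
    have "r * b r \<ge> 0" for r using b_sign[of r] by (cases "r = 0") auto
    then show "0 \<le> (\<Sum>i=1..n. q i * b (q i))" by (intro sum_nonneg) auto
  qed
  finally show ?thesis by (simp add: y_def)
qed

text \<open>The range of \<open>b\<close> keeps the radicand positive, so the square root is only
  evaluated where it is continuously differentiable.\<close>

lemma is_lipschitz_on_P:
  assumes A: "compact A" "connected A" and y: "is_lipschitz_on A y" and q: "is_lipschitz_on A q"
  shows "is_lipschitz_on A (\<lambda>x. P (y x) (q x))"
proof -
  note mult = is_lipschitz_on_mult[OF A(1)]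
  have bq: "is_lipschitz_on A (\<lambda>x. b (q x))"
    by (rule is_lipschitz_on_C1_compose[OF A q _ b_deriv db_cont]) auto
  define R where "R x = (y x)\<^sup>2 * vmax\<^sup>2 + 4 * (vmax - vstar + b (q x)) * (vstar - b (q x))" for x
  have R_pos: "R x > 0" for x
  proof -
    have "0 < vmax - vstar + b (q x)" "0 < vstar - b (q x)" using b_range[of "q x"] by auto
    then show ?thesis unfolding R_def by (intro add_nonneg_pos mult_pos_pos[of "4 * _"]) auto
  qed
  have "is_lipschitz_on A R"
    unfolding R_def power2_eq_square
    by (intro is_lipschitz_on_add is_lipschitz_on_diff mult is_lipschitz_on_const y bq)
  then have sqrt: "is_lipschitz_on A (\<lambda>x. sqrt (R x))"
    by (rule is_lipschitz_on_C1_compose[OF A, where \<phi> = sqrt and U = "{0<..}"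
          and \<phi>' = "\<lambda>x. inverse (sqrt x) / 2"])
      (auto intro!: continuous_intros DERIV_real_sqrt simp: R_pos)
  have pos: "2 * (1 + (y x)\<^sup>2) > 0" for x by (simp add: add_pos_nonneg)
  have "is_lipschitz_on A (\<lambda>x. 2 * (1 + (y x)\<^sup>2))"
    unfolding power2_eq_square by (intro is_lipschitz_on_add mult is_lipschitz_on_const y)
  then have inv: "is_lipschitz_on A (\<lambda>x. inverse (2 * (1 + (y x)\<^sup>2)))"
    by (rule is_lipschitz_on_C1_compose[OF A, where \<phi> = inverse and U = "{0<..}"
          and \<phi>' = "\<lambda>x. - (inverse x ^ Suc (Suc 0))"])
      (use pos in \<open>auto simp del: power_Suc intro!: continuous_intros DERIV_inverse\<close>)
  have "is_lipschitz_on A (\<lambda>x. (y x * (vmax - 2 * vstar + 2 * b (q x)) + sqrt (R x))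
      * inverse (2 * (1 + (y x)\<^sup>2)))"
    by (intro mult is_lipschitz_on_add is_lipschitz_on_diff is_lipschitz_on_const y bq sqrt inv)
  then show ?thesis by (simp add: P_fun_def divide_inverse R_def)
qed

text \<open>Convexity supplies the connectedness needed for composition, and
  \<open>C \<subseteq> D\<close> keeps the shifted positions where \<open>deriv Phi\<close> is
  continuously differentiable.\<close>

lemma rhs_lipschitz:
  assumes C: "compact C" "convex C" "C \<subseteq> D"
  shows "is_lipschitz_on (C \<times> C \<times> C) (\<lambda>(a, p, c). rhs a p c)"
proof -
  let ?A = "C \<times> C \<times> C"
  have A: "compact ?A" "connected ?A"
    using C by (auto intro!: compact_Times convex_connected convex_Times)
  have dPhi: "is_lipschitz_on ?A (\<lambda>x. deriv Phi (fst (g x) + lam))"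
    if "is_lipschitz_on ?A g" "g ` ?A \<subseteq> C" for g
  proof (rule is_lipschitz_on_C1_compose[OF A,
        where U = "{L<..}" and \<phi> = "deriv Phi" and \<phi>' = "deriv (deriv Phi)"])
    show "is_lipschitz_on ?A (\<lambda>x. fst (g x) + lam)"
      by (intro is_lipschitz_on_add is_lipschitz_on_fst is_lipschitz_on_const that)
    show "(\<lambda>x. fst (g x) + lam) ` ?A \<subseteq> {L<..}"
      using that(2) C(3) by (fastforce simp: image_subset_iff)
  qed (use dPhi_deriv ddPhi_cont in auto)
  have proj: "is_lipschitz_on ?A (\<lambda>x. fst x)" "is_lipschitz_on ?A (\<lambda>x. fst (snd x))"
    "is_lipschitz_on ?A (\<lambda>x. snd (snd x))"
    by (intro is_lipschitz_on_fst is_lipschitz_on_snd is_lipschitz_on_id)+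
  have "(\<lambda>x. fst x) ` ?A \<subseteq> C" "(\<lambda>x. fst (snd x)) ` ?A \<subseteq> C" "(\<lambda>x. snd (snd x)) ` ?A \<subseteq> C"
    by auto
  note d = dPhi[OF proj(1) this(1)] dPhi[OF proj(2) this(2)] dPhi[OF proj(3) this(3)]
  have b: "is_lipschitz_on ?A (\<lambda>x. b (q x))" if "is_lipschitz_on ?A q" for q
    by (rule is_lipschitz_on_C1_compose[OF A that _ b_deriv db_cont]) auto
  have "is_lipschitz_on ?A (\<lambda>x. rhs (fst x) (fst (snd x)) (snd (snd x)))"
    unfolding rhs_eq kappa_fun_def divide_inverse
    by (intro is_lipschitz_on_Pair is_lipschitz_on_diff is_lipschitz_on_mult[OF A(1)]
        is_lipschitz_on_P[OF A] b d is_lipschitz_on_const is_lipschitz_on_snd proj)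
  then show ?thesis by (simp add: case_prod_unfold)
qed

section \<open>Energy dissipation\<close>

lemma V_nonneg: "p \<in> D \<Longrightarrow> V p \<ge> 0"
  using Phi_nonneg[of "lam + fst p"] by (cases p) (auto simp: vehicle_V_def)

lemma V_eq: "V p = vmax\<^sup>2 / 2 * (snd p)\<^sup>2 + Phi (lam + fst p)"
  by (simp add: vehicle_V_def case_prod_beta)

lemma V_cont: "continuous_on D V"
proof -
  have "continuous_on {L<..} Phi"
    by (rule DERIV_continuous_on[OF has_field_derivative_at_within[OF Phi_deriv]]) auto
  then have "continuous_on D (\<lambda>p. Phi (lam + fst p))"
    by (rule continuous_on_compose2) (auto intro!: continuous_intros)
  then show ?thesis
    unfolding V_eq by (intro continuous_intros)
qed

text \<open>\<open>Phi\<close> is not Lipschitz near \<open>L\<close>, but the positions along a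
  trajectory over a compact time interval fill a compact interval to the right of \<open>L\<close>,
  on which it is.\<close>

lemma energy_abs_continuous_on:
  assumes ac: "abs_continuous_on {0..T} x" and D: "\<And>t. t \<in> {0..T} \<Longrightarrow> x t \<in> D"
  shows "abs_continuous_on {0..T} (\<lambda>t. V (x t))"
proof -
  have z: "abs_continuous_on {0..T} (\<lambda>t. lam + fst (x t))"
  proof (rule abs_continuous_on_dominated[OF ac ac, where M = 1])
    show "norm (lam + fst (x v) - (lam + fst (x u))) \<le> 1 * (norm (x v - x u) + norm (x v - x u))" for u v
      using dist_fst_le[of "x v" "x u"] norm_ge_zero[of "x v - x u"] unfolding dist_norm by simp
  qed
  have y: "abs_continuous_on {0..T} (\<lambda>t. snd (x t))"
  proof (rule abs_continuous_on_dominated[OF ac ac, where M = 1])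
    show "norm (snd (x v) - snd (x u)) \<le> 1 * (norm (x v - x u) + norm (x v - x u))" for u v
      using dist_snd_le[of "x v" "x u"] norm_ge_zero[of "x v - x u"] unfolding dist_norm by simp
  qed
  have Phi: "abs_continuous_on {0..T} (\<lambda>t. Phi (lam + fst (x t)))"
  proof -
    have "continuous_on {0..T} (\<lambda>t. lam + fst (x t))"
      by (rule abs_continuous_on_imp_continuous_on[OF z])
    then obtain c d where cd: "(\<lambda>t. lam + fst (x t)) ` {0..T} = {c..d}"
      using connected_compact_interval_1[of "(\<lambda>t. lam + fst (x t)) ` {0..T}"]
        connected_continuous_image[OF _ connected_Icc] compact_continuous_image[OF _ compact_Icc] by blast
    have sub: "{c..d} \<subseteq> {L<..}" unfolding cd[symmetric] using D by fastforce
    obtain M where "M-lipschitz_on {c..d} Phi"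
      by (rule C1_imp_lipschitz_on_Icc[of c d Phi "deriv Phi"])
        (use Phi_deriv sub continuous_on_subset[OF dPhi_cont sub] in auto)
    from abs_continuous_on_lipschitz_compose[OF z this] show ?thesis using cd by simp
  qed
  have sq: "abs_continuous_on {0..T} (\<lambda>t. vmax\<^sup>2 / 2 * (snd (x t))\<^sup>2)"
    using abs_continuous_on_Icc_inner[OF abs_continuous_on_const[of _ "vmax\<^sup>2 / 2"]
        abs_continuous_on_Icc_inner[OF y y]] by (simp add: power2_eq_square)
  show ?thesis unfolding V_eq by (rule abs_continuous_on_add[OF sq Phi])
qed

lemma energy_has_derivative:
  assumes x: "(x has_vector_derivative v) (at t within S)" and D: "x t \<in> D"
  shows "((\<lambda>s. V (x s)) has_real_derivative
    vmax\<^sup>2 * snd (x t) * snd v + deriv Phi (lam + fst (x t)) * fst v) (at t within S)"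
proof -
  have z: "((\<lambda>s. fst (x s)) has_real_derivative fst v) (at t within S)"
    and y: "((\<lambda>s. snd (x s)) has_real_derivative snd v) (at t within S)"
    unfolding has_real_derivative_iff_has_vector_derivative
    using bounded_linear.has_vector_derivative[OF bounded_linear_fst x]
      bounded_linear.has_vector_derivative[OF bounded_linear_snd x] by auto
  have "(Phi has_real_derivative deriv Phi (lam + fst (x t))) (at (lam + fst (x t)))"
    using D by (intro Phi_deriv) auto
  then have "((\<lambda>s. Phi (lam + fst (x s))) has_real_derivative
      deriv Phi (lam + fst (x t)) * fst v) (at t within S)"
    by (rule DERIV_chain2) (use DERIV_add[OF DERIV_const z, of lam] in simp)
  from DERIV_add[OF DERIV_cmult[OF DERIV_power[OF y, of 2], of "vmax\<^sup>2 / 2"] this]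
  show ?thesis unfolding V_eq by (simp add: mult_ac)
qed

lemma solution_output_integrable:
  assumes x: "string_solution f D n u w {0..T} x" and i: "i \<in> {1..n}"
  shows "(\<lambda>s. (snd (x s i))\<^sup>2) integrable_on {0..T}"
  by (intro integrable_continuous_real continuous_intros
      abs_continuous_on_imp_continuous_on[OF string_solution_abs_continuous_on[OF x i]])

lemma bounded_input_integrable:
  fixes u :: "real \<Rightarrow> real \<times> real"
  assumes u: "u \<in> borel_measurable (lebesgue_on {0..})"
    and bound: "\<And>t. t \<ge> 0 \<Longrightarrow> \<bar>snd (u t)\<bar> \<le> \<Lambda>" and "0 \<le> a"
  shows "(\<lambda>s. (snd (u s))\<^sup>2) integrable_on {a..T}"
proof (rule integrable_on_bounded_measurable[OF _ _ \<open>0 \<le> a\<close>])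
  have "(\<lambda>s. snd (u s)) \<in> borel_measurable (lebesgue_on {0..})"
    by (rule measurable_compose[OF u borel_measurable_continuous_onI[OF continuous_on_snd[OF continuous_on_id]]])
  then show "(\<lambda>s. (snd (u s))\<^sup>2) \<in> borel_measurable (lebesgue_on {0..})" by simp
  show "norm ((snd (u t))\<^sup>2) \<le> \<Lambda>\<^sup>2" if "t \<ge> 0" for t
    using power_mono[OF bound[OF that], of 2] by simp
qed

text \<open>The integrated form of \<open>energy_rate_le\<close>. The terminal energy is kept on the
  left: it confines solutions, while the output integrals give the stability estimate.\<close>

lemma dissipation:
  assumes x: "string_solution rhs D n u w {0..T} x" and n: "n \<ge> 1" and T: "T \<ge> 0" and c: "c \<ge> 0"
    and inflow: "\<And>q v. q \<le> 0 \<Longrightarrow> \<bar>v\<bar> \<le> \<Lambda> \<Longrightarrow> q * kappa v q \<le> c * v\<^sup>2"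
    and u: "u \<in> borel_measurable (lebesgue_on {0..})"
      "\<And>t. t \<ge> 0 \<Longrightarrow> fst (u t) \<ge> 0 \<and> \<bar>snd (u t)\<bar> \<le> \<Lambda>"
    and w: "\<And>t. t \<ge> 0 \<Longrightarrow> fst (w t) \<ge> 0"
  shows "(\<Sum>i=1..n. V (x T i)) + mu * vmax\<^sup>2 * (\<Sum>i=1..n. integral {0..T} (\<lambda>s. (snd (x s i))\<^sup>2))
    \<le> (\<Sum>i=1..n. V (x 0 i)) + c * integral {0..T} (\<lambda>s. (snd (u s))\<^sup>2)"
proof -
  \<comment> \<open>The negative of the bound in \<open>energy_rate_le\<close>. It is bounded, so
    its integral is Lipschitz, and total energy plus this integral does not increase.\<close>
  define \<psi> where "\<psi> s = mu * vmax\<^sup>2 * (\<Sum>i=1..n. (snd (x s i))\<^sup>2) - c * (snd (u s))\<^sup>2" for s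
  have x_ac: "abs_continuous_on {0..T} (\<lambda>t. x t i)" if "i \<in> {1..n}" for i
    by (rule string_solution_abs_continuous_on[OF x that])
  have x_D: "x t i \<in> D" if "t \<in> {0..T}" "i \<in> {1..n}" for t i
    by (rule string_solution_in_domain[OF x that])
  have u_int: "(\<lambda>s. (snd (u s))\<^sup>2) integrable_on {0..T}"
    by (rule bounded_input_integrable[OF u(1), of \<Lambda>]) (use u in auto)
  have y_int: "(\<lambda>s. (snd (x s i))\<^sup>2) integrable_on {0..T}" if "i \<in> {1..n}" for i
    by (rule solution_output_integrable[OF x that])
  have \<psi>_int: "\<psi> integrable_on {0..T}"
    unfolding \<psi>_def by (intro integrable_diff integrable_on_mult_right integrable_sum u_int y_int) auto
  have "continuous_on {0..T} (\<lambda>s. mu * vmax\<^sup>2 * (\<Sum>i=1..n. (snd (x s i))\<^sup>2))"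
    by (intro continuous_intros abs_continuous_on_imp_continuous_on x_ac)
  then have "bounded ((\<lambda>s. mu * vmax\<^sup>2 * (\<Sum>i=1..n. (snd (x s i))\<^sup>2)) ` {0..T})"
    by (intro compact_imp_bounded compact_continuous_image) auto
  then obtain Y where Y: "\<forall>s\<in>{0..T}. \<bar>mu * vmax\<^sup>2 * (\<Sum>i=1..n. (snd (x s i))\<^sup>2)\<bar> \<le> Y"
    by (auto simp: bounded_iff)
  have "norm (\<psi> s) \<le> max Y 0 + c * \<Lambda>\<^sup>2" if s: "s \<in> {0..T}" for s
  proof -
    have "(snd (u s))\<^sup>2 \<le> \<Lambda>\<^sup>2" using power_mono[of "\<bar>snd (u s)\<bar>" \<Lambda> 2] u(2)[of s] s by simp
    then have "c * (snd (u s))\<^sup>2 \<le> c * \<Lambda>\<^sup>2" "0 \<le> c * (snd (u s))\<^sup>2" using c by (auto intro: mult_left_mono)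
    moreover have "\<bar>mu * vmax\<^sup>2 * (\<Sum>i=1..n. (snd (x s i))\<^sup>2)\<bar> \<le> max Y 0"
      using Y s by (meson max.coboundedI1)
    ultimately show ?thesis unfolding \<psi>_def real_norm_def by linarith
  qed
  then have "(max Y 0 + c * \<Lambda>\<^sup>2)-lipschitz_on {0..T} (\<lambda>t. integral {0..t} \<psi>)"
    using c by (intro lipschitz_on_indefinite_integral \<psi>_int) auto
  then have ac: "abs_continuous_on {0..T} (\<lambda>t. (\<Sum>i=1..n. V (x t i)) + integral {0..t} \<psi>)"
    by (intro abs_continuous_on_add abs_continuous_on_sum energy_abs_continuous_on x_ac x_D
        lipschitz_on_imp_abs_continuous_on)
  have x_deriv: "AE t\<in>{0..T} in lebesgue. \<forall>i\<in>{1..n}. let X = with_boundary n (u t) (w t) (x t)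
      in ((\<lambda>s. x s i) has_vector_derivative rhs (X (i - 1)) (X i) (X (i + 1))) (at t within {0..T})"
    using x unfolding string_solution_def by blast
  have "AE t\<in>{0..T} in lebesgue. \<exists>d\<le>0.
      ((\<lambda>t. (\<Sum>i=1..n. V (x t i)) + integral {0..t} \<psi>) has_real_derivative d) (at t within {0..T})"
    using x_deriv has_vector_derivative_indefinite_integral_AE[OF \<psi>_int]
  proof eventually_elim
    case (elim t)
    show ?case
    proof
      assume t: "t \<in> {0..T}"
      define X where "X = with_boundary n (u t) (w t) (x t)"
      have X: "X 0 = u t" "X (Suc n) = w t" "\<And>i. i \<in> {1..n} \<Longrightarrow> X i = x t i"
        by (auto simp: X_def with_boundary_def)
      let ?e = "\<lambda>i. vmax\<^sup>2 * snd (X i) * snd (rhs (X (i - 1)) (X i) (X (i + 1)))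
        + deriv Phi (lam + fst (X i)) * fst (rhs (X (i - 1)) (X i) (X (i + 1)))"
      have "((\<lambda>s. V (x s i)) has_real_derivative ?e i) (at t within {0..T})" if i: "i \<in> {1..n}" for i
      proof -
        have "((\<lambda>s. x s i) has_vector_derivative rhs (X (i - 1)) (X i) (X (i + 1))) (at t within {0..T})"
          using elim t i unfolding X_def Let_def by blast
        from energy_has_derivative[OF this x_D[OF t i]] show ?thesis
          unfolding X(3)[OF i, symmetric] .
      qed
      then have "((\<lambda>t. (\<Sum>i=1..n. V (x t i)) + integral {0..t} \<psi>) has_real_derivative
          (\<Sum>i=1..n. ?e i) + \<psi> t) (at t within {0..T})"
        using elim t by (intro DERIV_add DERIV_sum)
          (auto simp: has_real_derivative_iff_has_vector_derivative)
      moreover have "(\<Sum>i=1..n. ?e i) \<le> c * (snd (X 0))\<^sup>2 - mu * vmax\<^sup>2 * (\<Sum>i=1..n. (snd (X i))\<^sup>2)"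
      proof (rule energy_rate_le)
        show "fst (X 1) + lam > L" using x_D[OF t, of 1] n X(3)[of 1] by auto
      qed (use t u w inflow X in \<open>auto intro!: dPhi_zero\<close>)
      then have "(\<Sum>i=1..n. ?e i) + \<psi> t \<le> 0"
        by (simp add: \<psi>_def X)
      ultimately show "\<exists>d\<le>0. ((\<lambda>t. (\<Sum>i=1..n. V (x t i)) + integral {0..t} \<psi>) has_real_derivative d)
          (at t within {0..T})"
        by blast
    qed
  qed
  from abs_continuous_on_AE_deriv_nonpos[OF ac T this]
  have "(\<Sum>i=1..n. V (x T i)) + integral {0..T} \<psi> \<le> (\<Sum>i=1..n. V (x 0 i))" by simp
  moreover have "integral {0..T} \<psi> = mu * vmax\<^sup>2 * (\<Sum>i=1..n. integral {0..T} (\<lambda>s. (snd (x s i))\<^sup>2))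
      - c * integral {0..T} (\<lambda>s. (snd (u s))\<^sup>2)"
  proof -
    have "integral {0..T} \<psi> = integral {0..T} (\<lambda>s. mu * vmax\<^sup>2 * (\<Sum>i=1..n. (snd (x s i))\<^sup>2))
        - integral {0..T} (\<lambda>s. c * (snd (u s))\<^sup>2)"
      unfolding \<psi>_def
      by (intro integral_diff integrable_on_mult_right integrable_sum u_int y_int) auto
    moreover have "integral {0..T} (\<lambda>s. \<Sum>i=1..n. (snd (x s i))\<^sup>2)
        = (\<Sum>i=1..n. integral {0..T} (\<lambda>s. (snd (x s i))\<^sup>2))"
      by (rule integral_sum) (use y_int in auto)
    ultimately show ?thesis by simp
  qed
  ultimately show ?thesis by simp
qed

text \<open>The rate of \<open>z\<close> is a difference of two values of \<open>kappa\<close>,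
  hence below \<open>vmax\<close>; the factor 2 is slack. It supplies the upper bound on
  \<open>z\<close> that the energy cannot give.\<close>

lemma position_bound:
  assumes x: "string_solution rhs D n u w {0..T} x" and T: "T \<ge> 0" and i: "i \<in> {1..n}"
  shows "fst (x T i) \<le> fst (x 0 i) + 2 * vmax * T"
proof -
  have ac: "abs_continuous_on {0..T} (\<lambda>t. fst (x t i) - 2 * vmax * t)"
  proof (rule abs_continuous_on_dominated)
    show "abs_continuous_on {0..T} (\<lambda>t. x t i)"
      by (rule string_solution_abs_continuous_on[OF x i])
    show "abs_continuous_on {0..T} (\<lambda>t. t)"
      by (rule lipschitz_on_imp_abs_continuous_on[OF lipschitz_on_id])
    fix s t
    have "norm (fst (x t i) - 2 * vmax * t - (fst (x s i) - 2 * vmax * s))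
        = \<bar>fst (x t i - x s i) - 2 * vmax * (t - s)\<bar>" by (simp add: algebra_simps)
    also have "\<dots> \<le> norm (x t i - x s i) + 2 * vmax * \<bar>t - s\<bar>"
      using dist_fst_le[of "x t i" "x s i"] vmax unfolding dist_norm
      by (intro order_trans[OF abs_triangle_ineq4] add_mono) (auto simp: abs_mult)
    also have "\<dots> \<le> (1 + 2 * vmax) * (norm (x t i - x s i) + norm (t - s))"
      using vmax by (simp add: algebra_simps)
    finally show "norm (fst (x t i) - 2 * vmax * t - (fst (x s i) - 2 * vmax * s))
        \<le> (1 + 2 * vmax) * (norm (x t i - x s i) + norm (t - s))" .
  qed
  have "AE t\<in>{0..T} in lebesgue. \<forall>i\<in>{1..n}. let X = with_boundary n (u t) (w t) (x t)
      in ((\<lambda>s. x s i) has_vector_derivative rhs (X (i - 1)) (X i) (X (i + 1))) (at t within {0..T})"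
    using x unfolding string_solution_def by blast
  then have "AE t\<in>{0..T} in lebesgue. \<exists>d\<le>0.
      ((\<lambda>t. fst (x t i) - 2 * vmax * t) has_real_derivative d) (at t within {0..T})"
  proof eventually_elim
    case (elim t)
    show ?case
    proof
      assume t: "t \<in> {0..T}"
      define X where "X = with_boundary n (u t) (w t) (x t)"
      let ?v = "rhs (X (i - 1)) (X i) (X (i + 1))"
      have "((\<lambda>s. x s i) has_vector_derivative ?v) (at t within {0..T})"
        using elim t i unfolding X_def Let_def by blast
      then have "((\<lambda>s. fst (x s i)) has_real_derivative fst ?v) (at t within {0..T})"
        unfolding has_real_derivative_iff_has_vector_derivative
        by (rule bounded_linear.has_vector_derivative[OF bounded_linear_fst])
      from DERIV_diff[OF this DERIV_cmult_Id[of "2 * vmax"]]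
      have "((\<lambda>t. fst (x t i) - 2 * vmax * t) has_real_derivative fst ?v - 2 * vmax) (at t within {0..T})" .
      moreover have "fst ?v \<le> vmax"
        unfolding rhs_eq fst_conv
        using kappa_bounds(2)[of "snd (X (i - 1))" "deriv Phi (fst (X i) + lam) - deriv Phi (fst (X (i - 1)) + lam)"]
          kappa_bounds(1)[of "snd (X i)" "deriv Phi (fst (X (i + 1)) + lam) - deriv Phi (fst (X i) + lam)"]
        by linarith
      ultimately show "\<exists>d\<le>0. ((\<lambda>t. fst (x t i) - 2 * vmax * t) has_real_derivative d) (at t within {0..T})"
        using vmax by (intro exI[of _ "fst ?v - 2 * vmax"]) auto
    qed
  qed
  from abs_continuous_on_AE_deriv_nonpos[OF ac T this] show ?thesis by simp
qed

section \<open>Confinement of solutions and forward completeness\<close>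

text \<open>Since \<open>deriv Phi\<close> vanishes on \<open>{lam..}\<close>, the boundary signals act only through the second
  component of \<open>u\<close>.\<close>

lemma string_solution_boundary:
  assumes x: "string_solution rhs D n u w J x" and J: "J \<subseteq> {0..}"
    and uw: "\<And>t. t \<ge> 0 \<Longrightarrow> fst (u t) \<ge> 0 \<and> fst (w t) \<ge> 0"
    and uw': "\<And>t. t \<ge> 0 \<Longrightarrow> fst (u' t) \<ge> 0 \<and> fst (w' t) \<ge> 0"
    and eq: "\<And>t. t \<ge> 0 \<Longrightarrow> snd (u t) = snd (u' t)"
  shows "string_solution rhs D n u' w' J x"
proof (rule string_solution_cong[OF x])
  show "x t \<in> states D n" if "t \<in> J" for t
    using x that by (auto simp: string_solution_def)
  fix t i assume "t \<in> J" and i: "i \<in> {1..n}"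
  then have t: "t \<ge> 0" using J by auto
  define X where "X = with_boundary n (u t) (w t) (x t)"
  define X' where "X' = with_boundary n (u' t) (w' t) (x t)"
  have "deriv Phi (fst (X k) + lam) = deriv Phi (fst (X' k) + lam)" for k
    using uw[OF t] uw'[OF t] by (auto simp: X_def X'_def with_boundary_def dPhi_zero)
  moreover have "snd (X (i - 1)) = snd (X' (i - 1))" "snd (X i) = snd (X' i)"
    using i eq[OF t] by (auto simp: X_def X'_def with_boundary_def)
  ultimately have "rhs (X (i - 1)) (X i) (X (i + 1)) = rhs (X' (i - 1)) (X' i) (X' (i + 1))"
    using i by (simp add: rhs_eq)
  then show "let X = with_boundary n (u t) (w t) (x t); X' = with_boundary n (u' t) (w' t) (x t)
      in rhs (X (i - 1)) (X i) (X (i + 1)) = rhs (X' (i - 1)) (X' i) (X' (i + 1))"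
    by (simp add: X_def X'_def Let_def)
qed

text \<open>Energy at most \<open>E\<close> keeps the position to the right of
  \<open>\<zeta>\<close>, by the blow-up of \<open>Phi\<close> at \<open>L\<close>. The bound
  \<open>\<zeta> < 0\<close> lets the box contain the position 0 of the modified boundary
  signals.\<close>

lemma Phi_barrier: "\<exists>\<zeta>. L - lam < \<zeta> \<and> \<zeta> < 0 \<and> (\<forall>z. L - lam < z \<longrightarrow> z \<le> \<zeta> \<longrightarrow> E < Phi (lam + z))"
proof -
  have "eventually (\<lambda>x. E < Phi x) (at_right L)"
    using Phi_lim by (simp add: filterlim_at_top_dense)
  then obtain d where d: "d > L" "\<And>x. L < x \<Longrightarrow> x < d \<Longrightarrow> E < Phi x"
    unfolding eventually_at_right_field by blast
  define m where "m = (L + min d lam) / 2"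
  have "L < min d lam" using d(1) L_less by simp
  then have m: "L < m" "m < d" "m < lam" by (auto simp: m_def)
  show ?thesis
    by (rule exI[of _ "m - lam"]) (use m in \<open>auto intro!: d(2)\<close>)
qed

lemma V_sublevel:
  assumes p: "p \<in> D" and E: "V p \<le> E"
  shows "\<bar>snd p\<bar> \<le> sqrt (2 * E) / vmax" "Phi (lam + fst p) \<le> E"
proof -
  have *: "Phi (lam + fst p) \<ge> 0" using p by (intro Phi_nonneg) auto
  then have "vmax\<^sup>2 / 2 * (snd p)\<^sup>2 \<le> E" using E unfolding V_eq by linarith
  then have "(vmax * snd p)\<^sup>2 \<le> 2 * E" by (simp add: power_mult_distrib)
  then have "\<bar>vmax * snd p\<bar> \<le> sqrt (2 * E)" by (rule real_le_rsqrt[of "\<bar>vmax * snd p\<bar>", simplified])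
  then show "\<bar>snd p\<bar> \<le> sqrt (2 * E) / vmax" using vmax by (simp add: abs_mult field_simps)
  show "Phi (lam + fst p) \<le> E" using E zero_le_power2[of "snd p"] vmax unfolding V_eq
    by (smt (verit) mult_nonneg_nonneg zero_le_power2 divide_nonneg_nonneg)
qed

text \<open>The box for horizon \<open>T\<close> has its left face from \<open>Phi_barrier\<close>,
  its right face from \<open>position_bound\<close> and its height from the kinetic part of
  \<open>V\<close>; \<open>dissipation\<close> supplies the energy level.\<close>

lemma vehicle_forward_complete:
  assumes n: "n \<ge> 1" and c: "c \<ge> 0" and "\<Lambda> \<ge> 0"
    and inflow: "\<And>q v. q \<le> 0 \<Longrightarrow> \<bar>v\<bar> \<le> \<Lambda> \<Longrightarrow> q * kappa v q \<le> c * v\<^sup>2"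
  shows "forward_complete rhs D ({0..} \<times> {-\<Lambda>..\<Lambda>}) ({0..} \<times> UNIV) n"
  unfolding forward_complete_def
proof (intro ballI)
  fix \<xi> :: "nat \<Rightarrow> real \<times> real" and u w :: "real \<Rightarrow> real \<times> real"
  assume \<xi>: "\<xi> \<in> states D n" and u: "u \<in> input_signals ({0..} \<times> {-\<Lambda>..\<Lambda>})"
    and w: "w \<in> input_signals ({0..} \<times> UNIV)"
  have u_in: "fst (u t) \<ge> 0 \<and> \<bar>snd (u t)\<bar> \<le> \<Lambda>" if "t \<ge> 0" for t
  proof -
    have "u t \<in> {0..} \<times> {-\<Lambda>..\<Lambda>}" using u that by (simp add: input_signals_def)
    then show ?thesis by (auto simp: abs_le_iff mem_Times_iff)
  qed
  have w_in: "fst (w t) \<ge> 0" if "t \<ge> 0" for t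
  proof -
    have "w t \<in> {0..} \<times> UNIV" using w that by (simp add: input_signals_def)
    then show ?thesis by (auto simp: mem_Times_iff)
  qed
  \<comment> \<open>Position 0 gives \<open>deriv Phi (0 + lam) = 0\<close>, the same value as every
    nonnegative position, and lies in all boxes.\<close>
  define u' where "u' t = (0 :: real, snd (u t))" for t
  define w' where "w' t = (0 :: real, 0 :: real)" for t :: real
  have u'_meas: "u' \<in> borel_measurable (lebesgue_on {0..})"
  proof -
    have "u \<in> borel_measurable (lebesgue_on {0..})" using u by (simp add: input_signals_def)
    then show ?thesis unfolding u'_def
      by (rule measurable_compose) (intro borel_measurable_continuous_onI continuous_intros)
  qed
  have \<xi>_D: "\<xi> i \<in> D" if "i \<in> {1..n}" for i
    using \<xi> that unfolding states_def by blast
  \<comment> \<open>Initial energy plus the largest supply \<open>c * \<Lambda>\<^sup>2\<close> per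
    unit time. The absolute value is there because the boxes are indexed by all real
    \<open>T\<close>.\<close>
  define E where "E T = (\<Sum>i=1..n. V (\<xi> i)) + c * \<Lambda>\<^sup>2 * \<bar>T\<bar>" for T
  obtain z0 where z0: "\<And>T. L - lam < z0 T" "\<And>T. z0 T < 0"
    "\<And>T z. L - lam < z \<Longrightarrow> z \<le> z0 T \<Longrightarrow> E T < Phi (lam + z)"
    using Phi_barrier[of "E _"] by metis
  define z1 where "z1 T = 1 + (\<Sum>i=1..n. \<bar>fst (\<xi> i)\<bar>) + 2 * vmax * \<bar>T\<bar>" for T
  \<comment> \<open>The summand 1 makes the confinement strict, as needed for the interior, and
    \<open>\<Lambda>\<close> makes room for the leader's output.\<close>
  define R where "R T = \<Lambda> + 1 + sqrt (2 * E T) / vmax" for T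
  define C where "C T = {z0 T..z1 T} \<times> {- R T..R T}" for T
  have E0: "E T \<ge> 0" for T
    unfolding E_def using c \<xi>_D V_nonneg by (intro add_nonneg_nonneg sum_nonneg) auto
  have R: "\<Lambda> < R T" for T unfolding R_def using E0[of T] vmax by (simp add: add_pos_nonneg)
  have z1: "z1 T > 0" for T
    unfolding z1_def using vmax by (intro add_pos_nonneg sum_nonneg) auto
  have C_interior: "interior (C T) = {z0 T<..<z1 T} \<times> {- R T<..<R T}" for T
    by (simp add: C_def interior_Times)
  have sublevel: "p \<in> interior (C T)" if p: "p \<in> D" "V p \<le> E T" "fst p < z1 T" for p T
  proof -
    have "z0 T < fst p" using z0(3)[of "fst p" T] V_sublevel(2)[OF p(1,2)] p(1)
      by (cases p) force
    moreover have "\<bar>snd p\<bar> < R T" using V_sublevel(1)[OF p(1,2)] \<open>\<Lambda> \<ge> 0\<close> unfolding R_def by linarith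
    ultimately show ?thesis using p(3) by (auto simp: C_interior mem_Times_iff abs_less_iff)
  qed
  have V_le_sum: "V (y i) \<le> (\<Sum>i=1..n. V (y i))" if "\<And>i. i \<in> {1..n} \<Longrightarrow> y i \<in> D" "i \<in> {1..n}" for y i
    by (rule member_le_sum) (use that V_nonneg in auto)
  have fst_le_sum: "fst (\<xi> i) \<le> (\<Sum>i=1..n. \<bar>fst (\<xi> i)\<bar>)" if "i \<in> {1..n}" for i
    using member_le_sum[of i "{1..n}" "\<lambda>i. \<bar>fst (\<xi> i)\<bar>"] that by auto
  have "\<exists>x. string_solution rhs D n u' w' {0..} x \<and> x 0 = \<xi> \<and>
    (\<forall>T>0. \<forall>x'. string_solution rhs D n u' w' {0..<T} x' \<and> x' 0 = \<xi> \<longrightarrow> (\<forall>t\<in>{0..<T}. x' t = x t))"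
  proof (rule string_global_solution_exists_unique)
    show C_props: "compact (C T)" "convex (C T)" "C T \<subseteq> D" for T
      using z0(1)[of T] by (auto simp: C_def intro!: compact_Times convex_Times)
    show "\<exists>M. M-lipschitz_on (C T \<times> C T \<times> C T) (\<lambda>(a, b, c). rhs a b c)" for T
      using rhs_lipschitz[OF C_props] by (simp add: is_lipschitz_on_def)
    show "u' \<in> borel_measurable (lebesgue_on {0..})" by (rule u'_meas)
    show "u' t \<in> C T" if "t \<ge> 0" for T t
      using u_in[OF that] R[of T] z0(2)[of T] z1[of T] by (auto simp: C_def u'_def)
    show "w' \<in> borel_measurable (lebesgue_on {0..})" unfolding w'_def[abs_def] by simp
    show "w' t \<in> C T" for T t
      using R[of T] z0(2)[of T] z1[of T] \<open>\<Lambda> \<ge> 0\<close> by (auto simp: C_def w'_def)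
    show "\<xi> \<in> states (C T) n" for T
    proof -
      have "\<xi> i \<in> interior (C T)" if i: "i \<in> {1..n}" for i
      proof (rule sublevel)
        show "\<xi> i \<in> D" by (rule \<xi>_D[OF i])
        show "V (\<xi> i) \<le> E T" using V_le_sum[of \<xi> i, OF \<xi>_D i] c by (simp add: E_def add_increasing2)
        have "0 \<le> 2 * vmax * \<bar>T\<bar>" using vmax by simp
        then show "fst (\<xi> i) < z1 T" unfolding z1_def using fst_le_sum[OF i] by linarith
      qed
      then show ?thesis using \<xi> interior_subset[of "C T"] by (auto simp: states_def PiE_iff)
    qed
    fix T t x i
    assume t: "t \<in> {0..T}" and x: "string_solution rhs D n u' w' {0..t} x" and x0: "x 0 = \<xi>"
      and i: "i \<in> {1..n}"
    have x_D: "x t i \<in> D" if "i \<in> {1..n}" for i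
      by (rule string_solution_in_domain[OF x _ that]) (use t in auto)
    show "x t i \<in> interior (C T)"
    proof (rule sublevel)
      show "x t i \<in> D" by (rule x_D[OF i])
      have "V (x t i) \<le> (\<Sum>i=1..n. V (x t i))" by (rule V_le_sum[of "x t", OF x_D i])
      also have "\<dots> \<le> (\<Sum>i=1..n. V (x t i))
          + mu * vmax\<^sup>2 * (\<Sum>i=1..n. integral {0..t} (\<lambda>s. (snd (x s i))\<^sup>2))"
        using mu solution_output_integrable[OF x]
        by (intro add_increasing2 mult_nonneg_nonneg sum_nonneg integral_nonneg) auto
      also have "\<dots> \<le> (\<Sum>i=1..n. V (x 0 i)) + c * integral {0..t} (\<lambda>s. (snd (u' s))\<^sup>2)"
        by (rule dissipation[OF x n _ c inflow u'_meas]) (use t u_in in \<open>auto simp: u'_def w'_def\<close>)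
      also have "integral {0..t} (\<lambda>s. (snd (u' s))\<^sup>2) \<le> integral {0..t} (\<lambda>s. \<Lambda>\<^sup>2)"
      proof (rule integral_le)
        show "(\<lambda>s. (snd (u' s))\<^sup>2) integrable_on {0..t}"
          by (rule bounded_input_integrable[OF u'_meas, of \<Lambda>]) (use u_in in \<open>auto simp: u'_def\<close>)
        show "(snd (u' s))\<^sup>2 \<le> \<Lambda>\<^sup>2" if "s \<in> {0..t}" for s
          using power_mono[of "\<bar>snd (u s)\<bar>" \<Lambda> 2] u_in[of s] that by (simp add: u'_def)
      qed auto
      also have "\<dots> = \<Lambda>\<^sup>2 * t" using t by simp
      also have "\<Lambda>\<^sup>2 * t \<le> \<Lambda>\<^sup>2 * \<bar>T\<bar>" using t by (intro mult_left_mono) auto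
      finally show "V (x t i) \<le> E T" using c by (simp add: E_def x0 mult_left_mono mult.assoc)
      have "fst (x t i) \<le> fst (\<xi> i) + 2 * vmax * t"
        using position_bound[OF x _ i] t x0 by auto
      also have "2 * vmax * t \<le> 2 * vmax * \<bar>T\<bar>" using t vmax by (intro mult_left_mono) auto
      finally show "fst (x t i) < z1 T" unfolding z1_def using fst_le_sum[OF i] by linarith
    qed
  qed
  then obtain x where x: "string_solution rhs D n u' w' {0..} x" "x 0 = \<xi>"
    and unique: "\<And>T x' t. T > 0 \<Longrightarrow> string_solution rhs D n u' w' {0..<T} x' \<Longrightarrow> x' 0 = \<xi> \<Longrightarrow>
      t \<in> {0..<T} \<Longrightarrow> x' t = x t"
    by blast
  have sol: "string_solution rhs D n u w {0..} x"
    by (rule string_solution_boundary[OF x(1)]) (use u_in w_in in \<open>auto simp: u'_def w'_def\<close>)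
  \<comment> \<open>Competing solutions for the original signals also solve the modified system, so
    uniqueness transfers back.\<close>
  have boundary: "string_solution rhs D n u' w' {0..<T} x'"
    if "string_solution rhs D n u w {0..<T} x'" for T x'
  proof (rule string_solution_boundary[OF that])
    show "{0..<T} \<subseteq> {0..}" by (simp add: subset_eq)
  qed (simp_all add: u_in w_in u'_def w'_def)
  show "\<exists>x. string_solution rhs D n u w {0..} x \<and> x 0 = \<xi> \<and>
    (\<forall>T>0. \<forall>x'. string_solution rhs D n u w {0..<T} x' \<and> x' 0 = \<xi> \<longrightarrow> (\<forall>t\<in>{0..<T}. x' t = x t))"
  proof (intro exI[of _ x] conjI allI impI ballI sol x(2))
    fix T x' t
    assume "T > 0" "string_solution rhs D n u w {0..<T} x' \<and> x' 0 = \<xi>" "t \<in> {0..<T}"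
    then show "x' t = x t" using unique[OF _ boundary, of T x' t] by simp
  qed
qed

section \<open>The string stability estimate\<close>

abbreviation "Q n \<equiv> (\<lambda>\<xi>. sqrt (1 / (mu * vmax\<^sup>2) * (\<Sum>i=1..n. V (\<xi> i))))"

lemma Q_nonneg_C0: "Q n \<in> nonneg_C0 (states D n)"
proof -
  have "continuous_on (states D n) (\<lambda>\<xi>. V (\<xi> i))" if "i \<in> {1..n}" for i
  proof (rule continuous_on_compose2[OF V_cont])
    show "continuous_on (states D n) (\<lambda>\<xi>. \<xi> i)"
      by (rule continuous_on_subset[OF continuous_on_product_coordinates]) simp
    show "(\<lambda>\<xi>. \<xi> i) ` states D n \<subseteq> D" using that unfolding states_def by blast
  qed
  then have "continuous_on (states D n) (Q n)"
    by (intro continuous_intros)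
  moreover have "0 \<le> Q n \<xi>" if "\<xi> \<in> states D n" for \<xi>
  proof -
    have "\<xi> i \<in> D" if "i \<in> {1..n}" for i
      using \<open>\<xi> \<in> states D n\<close> that unfolding states_def by blast
    then show ?thesis
      using mu V_nonneg by (intro real_sqrt_ge_zero mult_nonneg_nonneg sum_nonneg) auto
  qed
  ultimately show ?thesis by (auto simp: nonneg_C0_def)
qed

text \<open>In \<open>dissipation\<close>, the terminal energy and all output integrals but one are
  nonnegative and may be dropped. Division by \<open>mu * vmax\<^sup>2\<close> and subadditivity of
  the square root then separate the input from the initial energy.\<close>

lemma vehicle_estimate:
  assumes n: "n \<ge> 1" and c: "c \<ge> 0"
    and inflow: "\<And>q v. q \<le> 0 \<Longrightarrow> \<bar>v\<bar> \<le> \<Lambda> \<Longrightarrow> q * kappa v q \<le> c * v\<^sup>2"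
  shows "string_stability_estimate rhs vehicle_output D ({0..} \<times> {-\<Lambda>..\<Lambda>}) ({0..} \<times> UNIV) n
    (\<lambda>s. sqrt (c / (mu * vmax\<^sup>2)) * s) (\<lambda>s. 0) (Q n)"
  unfolding string_stability_estimate_def
proof (intro ballI allI impI, elim conjE)
  fix \<xi> u w x i and t :: real
  assume u: "u \<in> input_signals ({0..} \<times> {-\<Lambda>..\<Lambda>})" and w: "w \<in> input_signals ({0..} \<times> UNIV)"
    and x: "string_solution rhs D n u w {0..} x" and x0: "x 0 = \<xi>" and t: "0 \<le> t" and i: "i \<in> {1..n}"
  have u_in: "fst (u t) \<ge> 0 \<and> \<bar>snd (u t)\<bar> \<le> \<Lambda>" if "t \<ge> 0" for t
  proof -
    have "u t \<in> {0..} \<times> {-\<Lambda>..\<Lambda>}" using u that by (simp add: input_signals_def)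
    then show ?thesis by (auto simp: abs_le_iff mem_Times_iff)
  qed
  have u_meas: "u \<in> borel_measurable (lebesgue_on {0..})" using u by (simp add: input_signals_def)
  have w_in: "fst (w t) \<ge> 0" if "t \<ge> 0" for t
  proof -
    have "w t \<in> {0..} \<times> UNIV" using w that by (simp add: input_signals_def)
    then show ?thesis by (auto simp: mem_Times_iff)
  qed
  have xt: "string_solution rhs D n u w {0..t} x"
    by (rule string_solution_subset[OF x]) auto
  define Y where "Y i = integral {0..t} (\<lambda>s. (snd (x s i))\<^sup>2)" for i
  define U where "U = integral {0..t} (\<lambda>s. (snd (u s))\<^sup>2)"
  have y_int: "(\<lambda>s. (snd (x s i))\<^sup>2) integrable_on {0..t}" if "i \<in> {1..n}" for i
    by (rule solution_output_integrable[OF xt that])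
  have u_int: "(\<lambda>s. (snd (u s))\<^sup>2) integrable_on {0..t}"
    by (rule bounded_input_integrable[OF u_meas, of \<Lambda>]) (use u_in in auto)
  have m: "mu * vmax\<^sup>2 > 0" using mu vmax by simp
  have x_D: "x s i \<in> D" if "s \<ge> 0" "i \<in> {1..n}" for s i
    using string_solution_in_domain[OF x] that by simp
  have "mu * vmax\<^sup>2 * Y i \<le> mu * vmax\<^sup>2 * (\<Sum>i=1..n. Y i)"
    using m y_int i unfolding Y_def by (intro mult_left_mono member_le_sum integral_nonneg) auto
  also have "\<dots> \<le> (\<Sum>i=1..n. V (x t i)) + mu * vmax\<^sup>2 * (\<Sum>i=1..n. Y i)"
    using x_D[OF t] V_nonneg by (intro add_increasing sum_nonneg) auto
  also have "\<dots> \<le> (\<Sum>i=1..n. V (\<xi> i)) + c * U"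
    unfolding Y_def U_def x0[symmetric]
    by (rule dissipation[OF xt n t c inflow u_meas]) (use u_in w_in in auto)
  finally have "Y i * (mu * vmax\<^sup>2) \<le> (\<Sum>i=1..n. V (\<xi> i)) + c * U" by (simp only: mult.commute)
  then have "Y i \<le> ((\<Sum>i=1..n. V (\<xi> i)) + c * U) / (mu * vmax\<^sup>2)"
    by (simp only: pos_le_divide_eq[OF m])
  then have "Y i \<le> c / (mu * vmax\<^sup>2) * U + 1 / (mu * vmax\<^sup>2) * (\<Sum>i=1..n. V (\<xi> i))"
    by (simp add: add_divide_distrib add.commute)
  then have "sqrt (Y i) \<le> sqrt (c / (mu * vmax\<^sup>2) * U + 1 / (mu * vmax\<^sup>2) * (\<Sum>i=1..n. V (\<xi> i)))"
    by (rule real_sqrt_le_mono)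
  also have "\<dots> \<le> sqrt (c / (mu * vmax\<^sup>2) * U) + Q n \<xi>"
  proof (rule sqrt_add_le_add_sqrt)
    show "0 \<le> c / (mu * vmax\<^sup>2) * U"
      using c m u_int unfolding U_def by (intro mult_nonneg_nonneg divide_nonneg_pos integral_nonneg) auto
    show "0 \<le> 1 / (mu * vmax\<^sup>2) * (\<Sum>i=1..n. V (\<xi> i))"
      using m x_D[of 0] x0 V_nonneg by (intro mult_nonneg_nonneg sum_nonneg) auto
  qed
  finally have "sqrt (Y i) \<le> sqrt (c / (mu * vmax\<^sup>2)) * sqrt U + Q n \<xi>"
    by (simp only: real_sqrt_mult)
  moreover have "L2_norm_upto t (\<lambda>s. vehicle_output (x s i)) = sqrt (Y i)"
    using L2_norm_upto_eq_integral[of "\<lambda>s. vehicle_output (x s i)" t] y_int[OF i]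
    by (simp add: vehicle_output_def case_prod_beta Y_def)
  moreover have "L2_norm_upto t (\<lambda>s. vehicle_output (u s)) = sqrt U"
    using L2_norm_upto_eq_integral[of "\<lambda>s. vehicle_output (u s)" t] u_int
    by (simp add: vehicle_output_def case_prod_beta U_def)
  ultimately show "L2_norm_upto t (\<lambda>s. vehicle_output (x s i))
      \<le> sqrt (c / (mu * vmax\<^sup>2)) * L2_norm_upto t (\<lambda>s. vehicle_output (u s)) + 0 + Q n \<xi>"
    by simp
qed

end

theorem proposition6:
  fixes L lam vmax vstar mu :: real and Phi b :: "real \<Rightarrow> real"
    and D S :: "(real \<times> real) set" and Omega :: "real \<Rightarrow> (real \<times> real) set"
    and f :: "real \<times> real \<Rightarrow> real \<times> real \<Rightarrow> real \<times> real \<Rightarrow> real \<times> real"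
  assumes "0 < L" and "L < lam" and "vmax > 0" and "vstar \<in> {0<..<vmax}" and "mu > 0"
    and "Ck_on 3 Phi {L<..}" and "\<And>x. x > L \<Longrightarrow> Phi x \<ge> 0"
    and "filterlim Phi at_top (at_right L)"
    and "\<And>x. x \<ge> lam \<Longrightarrow> Phi x = 0"
    and "\<And>x. x \<in> {L<..<lam} \<Longrightarrow> deriv Phi x < 0"
    and "\<And>x. x \<in> {L<..<lam} \<Longrightarrow> deriv (deriv Phi) x > 0"
    and "Ck_on 2 b UNIV" and "strict_mono b" and "\<And>x. b x \<in> {vstar - vmax<..<vstar}"
    and "b 0 = 0" and "\<And>x. x \<noteq> 0 \<Longrightarrow> x * b x > 0" and "\<And>x. deriv b x > 0"
  defines "D \<equiv> {L - lam<..} \<times> UNIV"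
    and "S \<equiv> {0..} \<times> UNIV"
    and "Omega \<equiv> \<lambda>Lambda. {0..} \<times> {-Lambda..Lambda}"
    and "f \<equiv> vehicle_rhs lam vmax vstar mu Phi b"
  shows "\<exists>K>0. \<exists>Lambda>0.
    L2_string_stable f vehicle_output D (Omega Lambda) S \<and>
    (\<forall>n\<ge>1.
       let Q = (\<lambda>\<xi>. sqrt (1 / (mu * vmax\<^sup>2) * (\<Sum>i=1..n. vehicle_V lam vmax Phi (\<xi> i))))
       in Q \<in> nonneg_C0 (states D n) \<and>
          string_stability_estimate f vehicle_output D (Omega Lambda) S n (\<lambda>s. K * s) (\<lambda>s. 0) Q)"
proof -
  interpret vehicle_string L lam vmax vstar mu Phi b
    using assms(1-17) by unfold_locales auto
  obtain \<Lambda> c where "\<Lambda> > 0" "c > 0"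
    and inflow: "\<And>q v. q \<le> 0 \<Longrightarrow> \<bar>v\<bar> \<le> \<Lambda> \<Longrightarrow> q * kappa v q \<le> c * v\<^sup>2"
    using inflow_bound by blast
  \<comment> \<open>\<open>c\<close> and \<open>\<Lambda>\<close> were fixed before any
    \<open>n\<close>, so this gain is uniform in the length of the string.\<close>
  define K where "K = sqrt (c / (mu * vmax\<^sup>2))"
  have "K > 0" using \<open>c > 0\<close> mu vmax by (simp add: K_def)
  have complete: "forward_complete f D (Omega \<Lambda>) S n" if "n \<ge> 1" for n
    unfolding f_def D_def Omega_def S_def
    by (rule vehicle_forward_complete[OF that _ _ inflow]) (use \<open>\<Lambda> > 0\<close> \<open>c > 0\<close> in auto)
  have Q: "Q n \<in> nonneg_C0 (states D n)" for n
    unfolding D_def by (rule Q_nonneg_C0)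
  have estimate: "string_stability_estimate f vehicle_output D (Omega \<Lambda>) S n (\<lambda>s. K * s) (\<lambda>s. 0) (Q n)"
    if "n \<ge> 1" for n
    unfolding f_def D_def Omega_def S_def K_def
    by (rule vehicle_estimate[OF that _ inflow]) (use \<open>c > 0\<close> in auto)
  have "(\<lambda>s. K * s) \<in> nonneg_C0 {0..}" "(\<lambda>s. 0) \<in> nonneg_C0 {0..}"
    "mono_on {0..} (\<lambda>s. K * s)" "mono_on {0..} (\<lambda>s. 0 :: real)"
    using \<open>K > 0\<close> by (auto simp: nonneg_C0_def mono_on_def intro!: continuous_intros)
  note a1_a2 = this
  have "L2_string_stable f vehicle_output D (Omega \<Lambda>) S"
    unfolding L2_string_stable_def
    by (intro bexI[OF _ a1_a2(1)] bexI[OF _ a1_a2(2)] conjI allI impI a1_a2 complete bexI[OF _ Q] estimate)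
  then show ?thesis
    unfolding Let_def
    by (intro exI[of _ K] exI[of _ \<Lambda>] conjI allI impI \<open>K > 0\<close> \<open>\<Lambda> > 0\<close> Q estimate)
qed

end
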